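(* Let $k\ge 0$ and $i\in\{0,1\}$ be integers with $2k+i\ge1$. Then $I(C^H_{1,2k+i})$ has the same simple homotopy type as $$\begin{cases} \bigvee_2\Diamond^{2k-1} & (i=0),\\ * & (i=1),\end{cases}$$ where $*$ denotes the one-point complex.
   Context: Graphs are finite and undirected; loops and multiple edges are allowed. The planar square grid graph $P_{m,n}$ has vertex set $\{1,\dots,m\}\times\{1,\dots,n\}$, with $(i_1,j_1)$ and $(i_2,j_2)$ adjacent if and only if they differ by exactly $1$ in one coordinate and agree in the other. For $m,n\ge1$, $C_{m,n}$ is the graph obtained from $P_{m,n+1}$ by identifying the vertices $(i,1)$ and $(i,n+1)$ for $i=1,\dots,m$ and the corresponding edges (edge $(i,1)(i+1,1)$ with edge $(i,n+1)(i+1,n+1)$). $C^H_{m,n}$ is the graph obtained from $C_{m+1,2n}$ by removing all the edges $(i,j)(i-1,j)$ such that $i-j$ is even ($2\le i\le m+1$, $1\le j\le 2n$). An independent set of a graph is a set of vertices no two of which are joined by an edge (a vertex carrying a loop belongs to no independent set). The independence complex $I(G)$ is the simplicial complex whose simplices are the independent sets of $G$ (including the empty set $\emptyset$). $\Diamond^n$ is the join of $n+1$ copies of $\partial\Delta^1$ (two points), a triangulation of the $n$-sphere. $\bigvee_r K$ is the wedge sum of $r$ copies of $K$, obtained from their disjoint union by identifying one vertex from each copy to a single vertex. An elementary collapse of a simplicial complex removes a pair of simplices $\sigma\subsetneq\tau$, with $\sigma$ nonempty, $\dim\tau=\dim\sigma+1$, and $\tau$ the only simplex properly containing $\sigma$;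 an elementary expansion is the inverse operation. Two finite simplicial complexes have the same simple homotopy type if they are connected, up to simplicial isomorphism, by a finite sequence of elementary collapses and elementary expansions. *)

theory Defs
  imports Main
begin

section \<open>Graphs with loops and multiple edges\<close>

text \<open>An edge \<open>e\<close> is a name with a set \<open>ends G e\<close> of one (loop) or two endpoints, so that parallel
  edges are possible.\<close>

record ('v, 'e) multigraph =
  verts :: "'v set"
  edges :: "'e set"
  ends :: "'e \<Rightarrow> 'v set"

text \<open>The edges of the (simple) grid graph are named by their sets of endpoints.\<close>

definition grid_adjacent :: "nat \<times> nat \<Rightarrow> nat \<times> nat \<Rightarrow> bool" where
  "grid_adjacent u v \<longleftrightarrow>
     (fst u = fst v \<and> (snd u = snd v + 1 \<or> snd v = snd u + 1)) \<or>
     (snd u = snd v \<and> (fst u = fst v + 1 \<or> fst v = fst u + 1))"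

definition grid_graph :: "nat \<Rightarrow> nat \<Rightarrow> (nat \<times> nat, (nat \<times> nat) set) multigraph" where
  "grid_graph m n = (let V = {1..m} \<times> {1..n} in
     \<lparr> verts = V, edges = {{u, v} | u v. u \<in> V \<and> v \<in> V \<and> grid_adjacent u v}, ends = (\<lambda>e. e) \<rparr>)"

text \<open>Identification of vertices and edges. The maps \<open>f\<close> and \<open>g\<close> send a vertex, respectively an edge,
  to the representative of its class; only the values of \<open>ends\<close> at representatives matter.\<close>

definition identify ::
    "('v \<Rightarrow> 'v) \<Rightarrow> ('e \<Rightarrow> 'e) \<Rightarrow> ('v, 'e) multigraph \<Rightarrow> ('v, 'e) multigraph" where
  "identify f g G =
     \<lparr> verts = f ` verts G, edges = g ` edges G, ends = (\<lambda>e. f ` ends G e) \<rparr>"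

definition glue_vertex :: "nat \<Rightarrow> nat \<times> nat \<Rightarrow> nat \<times> nat" where
  "glue_vertex n v = (if snd v = n + 1 then (fst v, 1) else v)"

definition glue_edge :: "nat \<Rightarrow> (nat \<times> nat) set \<Rightarrow> (nat \<times> nat) set" where
  "glue_edge n e = (if \<forall>v\<in>e. snd v = n + 1 then glue_vertex n ` e else e)"

text \<open>Horizontal edges keep their names from the grid with \<open>n + 1\<close> columns. So for \<open>n = 2\<close> each row
  carries two parallel edges, and for \<open>n = 1\<close> a loop.\<close>

definition cyl_graph :: "nat \<Rightarrow> nat \<Rightarrow> (nat \<times> nat, (nat \<times> nat) set) multigraph" where
  "cyl_graph m n = identify (glue_vertex n) (glue_edge n) (grid_graph m (n + 1))"

definition hex_cyl_graph :: "nat \<Rightarrow> nat \<Rightarrow> (nat \<times> nat, (nat \<times> nat) set) multigraph" where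
  "hex_cyl_graph m n = (let G = cyl_graph (m + 1) (2 * n) in
     G \<lparr> edges := edges G - {e. \<exists>i j. 2 \<le> i \<and> i \<le> m + 1 \<and> 1 \<le> j \<and> j \<le> 2 * n \<and>
                               even (int i - int j) \<and> ends G e = {(i, j), (i - 1, j)}} \<rparr>)"

section \<open>Finite simplicial complexes\<close>

text \<open>A complex is the set of its simplices, the empty simplex included.\<close>

definition fin_complex :: "'a set set \<Rightarrow> bool" where
  "fin_complex K \<longleftrightarrow>
     finite K \<and> {} \<in> K \<and> (\<forall>\<sigma>\<in>K. finite \<sigma> \<and> (\<forall>\<rho>. \<rho> \<subseteq> \<sigma> \<longrightarrow> \<rho> \<in> K))"

text \<open>For a loop, \<open>ends G e\<close> is a singleton, so its vertex is in no independent set.\<close>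

definition independence_complex :: "('v, 'e) multigraph \<Rightarrow> 'v set set" where
  "independence_complex G = {\<sigma>. \<sigma> \<subseteq> verts G \<and> (\<forall>e\<in>edges G. \<not> ends G e \<subseteq> \<sigma>)}"

definition point_complex :: "unit set set" where
  "point_complex = {{}, {()}}"

definition simplex_boundary :: "nat \<Rightarrow> nat set set" where
  "simplex_boundary n = {\<sigma>. \<sigma> \<subset> {0..n}}"

text \<open>Join of a family of complexes: its vertex set is the disjoint union of theirs, and a simplex is
  a union of one (possibly empty) simplex from each.\<close>

definition join :: "'i set \<Rightarrow> ('i \<Rightarrow> 'a set set) \<Rightarrow> ('i \<times> 'a) set set" where
  "join I K = {Sigma I s | s. \<forall>i\<in>I. s i \<in> K i}"

definition diamond :: "nat \<Rightarrow> (nat \<times> nat) set set" where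
  "diamond n = join {0..n} (\<lambda>_. simplex_boundary 1)"

text \<open>Wedge of \<open>r \<ge> 1\<close> copies of \<open>K\<close>: \<open>b j\<close> is the vertex chosen in copy \<open>j\<close>, and \<open>None\<close> is the common
  vertex replacing all of them.\<close>

definition wedge_vertex :: "(nat \<Rightarrow> 'a) \<Rightarrow> nat \<times> 'a \<Rightarrow> (nat \<times> 'a) option" where
  "wedge_vertex b v = (if snd v = b (fst v) then None else Some v)"

definition wedge :: "nat \<Rightarrow> 'a set set \<Rightarrow> (nat \<Rightarrow> 'a) \<Rightarrow> (nat \<times> 'a) option set set" where
  "wedge r K b = {wedge_vertex b ` ({j} \<times> \<sigma>) | j \<sigma>. j < r \<and> \<sigma> \<in> K}"

section \<open>Simple homotopy type\<close>

definition complex_iso :: "'a set set \<Rightarrow> 'b set set \<Rightarrow> bool" where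
  "complex_iso K L \<longleftrightarrow> (\<exists>f. inj_on f (\<Union>K) \<and> L = (\<lambda>\<sigma>. f ` \<sigma>) ` K)"

definition elementary_collapse :: "'a set set \<Rightarrow> 'a set set \<Rightarrow> bool" where
  "elementary_collapse K L \<longleftrightarrow>
     fin_complex K \<and>
     (\<exists>\<sigma>\<in>K. \<exists>\<tau>\<in>K. \<sigma> \<noteq> {} \<and> \<sigma> \<subset> \<tau> \<and> card \<tau> = card \<sigma> + 1 \<and>
        (\<forall>\<rho>\<in>K. \<sigma> \<subset> \<rho> \<longrightarrow> \<rho> = \<tau>) \<and> L = K - {\<sigma>, \<tau>})"

definition simple_homotopy_move :: "'a set set \<Rightarrow> 'a set set \<Rightarrow> bool" where
  "simple_homotopy_move K L \<longleftrightarrow>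
     elementary_collapse K L \<or> elementary_collapse L K \<or> complex_iso K L"

text \<open>The moves are performed on isomorphic copies with vertices in \<open>nat\<close>: this lets \<open>K\<close> and \<open>L\<close> have
  different vertex types and leaves an unlimited supply of new vertices for expansions.\<close>

definition same_simple_homotopy_type :: "'a set set \<Rightarrow> 'b set set \<Rightarrow> bool" where
  "same_simple_homotopy_type K L \<longleftrightarrow>
     fin_complex K \<and> fin_complex L \<and>
     (\<exists>(K' :: nat set set) (L' :: nat set set).
        complex_iso K K' \<and> complex_iso L L' \<and> simple_homotopy_move\<^sup>*\<^sup>* K' L')"

end

(* Write x_j, y_j for the ends of the j-th rung and u_j, v_j for the vertices of degree two between
   x_j and x_(j+1), respectively y_j and y_(j+1), with indices modulo n. A non-edge {a, b} may be
   added to a graph without changing the simple homotopy type of its independence complex if there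
   is a vertex t whose neighbours are all adjacent to a or to b: toggling t pairs off the simplices
   containing a and b. The same holds for arbitrary forbidden sets in place of edges, so a single
   vertex can be deleted as well.

   With t running through v_1, u_2, v_3, ... this makes x_1 adjacent to x_2, v_2, y_3, u_3, x_4, ...
   one after the other. If n is odd, then x_1 itself can be deleted next, and a second run around
   the ring, starting with t = u_1, leaves a cone with apex u_n. If n is even, then u_(n-1) is
   deleted and a similar run attaches edges at x_n. After that every vertex of the outer sphere
   is joined to every vertex of the inner sphere except for the common vertex u_n, and what remains
   is literally a wedge of two cross-polytopal spheres at u_n, with antipodal pairs
   y_1 v_n, u_1 x_2, v_2 y_3, ..., v_(n-2) y_(n-1), x_n u_n and, respectively,
   x_1 u_n, v_1 y_2, u_2 x_3, ..., v_(n-1) y_n. *)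

theory Submission
  imports Defs
begin

lemma inj_on_image_subset_cancel:
  assumes "inj_on f A" "B \<subseteq> A" "C \<subseteq> A"
  shows "f ` B \<subseteq> f ` C \<longleftrightarrow> B \<subseteq> C"
  using assms unfolding inj_on_def by blast

section \<open>Simple homotopy type as an equivalence relation\<close>

lemma fin_complex_finite_vertices: "fin_complex K \<Longrightarrow> finite (\<Union>K)"
  by (auto simp: fin_complex_def)

lemma fin_complex_image:
  assumes "fin_complex K"
  shows "fin_complex ((\<lambda>\<sigma>. f ` \<sigma>) ` K)"
proof -
  have "\<rho> \<in> (\<lambda>\<sigma>. f ` \<sigma>) ` K" if "\<sigma> \<in> K" "\<rho> \<subseteq> f ` \<sigma>" for \<rho> \<sigma>
    using that assms unfolding fin_complex_def subset_image_iff by blast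
  then show ?thesis
    using assms unfolding fin_complex_def by (auto intro: rev_image_eqI)
qed

lemma complex_iso_fin_complex: "complex_iso K L \<Longrightarrow> fin_complex K \<Longrightarrow> fin_complex L"
  by (auto simp: complex_iso_def fin_complex_image)

lemma complex_iso_sym:
  assumes "complex_iso K L"
  shows "complex_iso L K"
proof -
  obtain f where f: "inj_on f (\<Union>K)" and L: "L = (\<lambda>\<sigma>. f ` \<sigma>) ` K"
    using assms by (auto simp: complex_iso_def)
  let ?g = "inv_into (\<Union>K) f"
  have UL: "\<Union>L = f ` \<Union>K"
    using L by auto
  have "?g ` f ` \<sigma> = \<sigma>" if "\<sigma> \<in> K" for \<sigma>
    using f that by (simp add: Union_upper inv_into_image_cancel)
  then have "K = (\<lambda>\<sigma>. ?g ` \<sigma>) ` L"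
    unfolding L image_image by simp
  moreover have "inj_on ?g (\<Union>L)"
    unfolding UL by (rule inj_on_inv_into) simp
  ultimately show ?thesis
    by (auto simp: complex_iso_def)
qed

lemma complex_iso_trans:
  assumes "complex_iso K L" "complex_iso L M"
  shows "complex_iso K M"
proof -
  obtain f where f: "inj_on f (\<Union>K)" and L: "L = (\<lambda>\<sigma>. f ` \<sigma>) ` K"
    using assms by (auto simp: complex_iso_def)
  obtain g where g: "inj_on g (\<Union>L)" and M: "M = (\<lambda>\<sigma>. g ` \<sigma>) ` L"
    using assms by (auto simp: complex_iso_def)
  have "\<Union>L = f ` \<Union>K"
    using L by auto
  then have "inj_on (g \<circ> f) (\<Union>K)"
    using f g by (simp add: comp_inj_on)
  moreover have "M = (\<lambda>\<sigma>. (g \<circ> f) ` \<sigma>) ` K"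
    unfolding M L by (simp add: image_comp image_image)
  ultimately show ?thesis
    unfolding complex_iso_def by blast
qed

lemma complex_iso_nat:
  assumes "fin_complex K"
  obtains f :: "'a \<Rightarrow> nat" where "inj_on f (\<Union>(K :: 'a set set))"
  using finite_imp_inj_to_nat_seg[OF fin_complex_finite_vertices[OF assms]] by blast

text \<open>One copy of \<open>K\<close> with vertices in \<open>nat\<close> is a copy of
  \<open>L\<close> as well, so the empty sequence of moves suffices.\<close>

lemma same_type_iso:
  assumes "fin_complex (K :: 'a set set)" "complex_iso K (L :: 'b set set)"
  shows "same_simple_homotopy_type K L"
proof -
  obtain f :: "'a \<Rightarrow> nat" where "inj_on f (\<Union>K)"
    using complex_iso_nat[OF assms(1)] .
  then have "complex_iso K ((\<lambda>\<sigma>. f ` \<sigma>) ` K)"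
    by (auto simp: complex_iso_def)
  then show ?thesis
    unfolding same_simple_homotopy_type_def
    using assms complex_iso_fin_complex complex_iso_sym complex_iso_trans by blast
qed

lemma same_type_refl: "fin_complex K \<Longrightarrow> same_simple_homotopy_type K K"
  by (rule same_type_iso) (auto simp: complex_iso_def intro!: exI[of _ id])

lemma same_type_sym:
  assumes "same_simple_homotopy_type K L"
  shows "same_simple_homotopy_type L K"
proof -
  have "symp simple_homotopy_move"
    using complex_iso_sym by (auto simp: symp_def simple_homotopy_move_def)
  then have "simple_homotopy_move\<^sup>*\<^sup>* L' K'" if "simple_homotopy_move\<^sup>*\<^sup>* K' L'" for K' L' :: "nat set set"
    using that by (meson sympD symp_rtranclp)
  then show ?thesis
    using assms unfolding same_simple_homotopy_type_def by blast
qed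

lemma same_type_trans:
  assumes "same_simple_homotopy_type K L" "same_simple_homotopy_type L M"
  shows "same_simple_homotopy_type K M"
proof -
  obtain K' L' L'' M' :: "nat set set" where
    iso: "complex_iso K K'" "complex_iso L L'" "complex_iso L L''" "complex_iso M M'" and
    moves: "simple_homotopy_move\<^sup>*\<^sup>* K' L'" "simple_homotopy_move\<^sup>*\<^sup>* L'' M'"
    using assms unfolding same_simple_homotopy_type_def by blast
  \<comment> \<open>The two hypotheses may come with different copies of \<open>L\<close>; an
    isomorphism move bridges them.\<close>
  have "complex_iso L' L''"
    using iso complex_iso_sym complex_iso_trans by blast
  then have "simple_homotopy_move L' L''"
    by (simp add: simple_homotopy_move_def)
  then have "simple_homotopy_move\<^sup>*\<^sup>* K' M'"
    using moves by (meson converse_rtranclp_into_rtranclp rtranclp_trans)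
  then show ?thesis
    using assms iso unfolding same_simple_homotopy_type_def by blast
qed

section \<open>Elementary collapses under relabelling of vertices\<close>

lemma elementary_collapseI:
  assumes "fin_complex K" "\<sigma> \<in> K" "\<tau> \<in> K" "\<sigma> \<noteq> {}" "\<sigma> \<subset> \<tau>" "card \<tau> = card \<sigma> + 1"
    and "\<And>\<rho>. \<rho> \<in> K \<Longrightarrow> \<sigma> \<subset> \<rho> \<Longrightarrow> \<rho> = \<tau>" "L = K - {\<sigma>, \<tau>}"
  shows "elementary_collapse K L"
  unfolding elementary_collapse_def
  by (rule conjI[OF assms(1) bexI[OF bexI[OF _ assms(3)] assms(2)]]) (intro conjI ballI impI assms)

text \<open>Moves are performed on copies in \<open>nat\<close>, so collapses have to be
  transported. A map injective on the vertices preserves and reflects inclusions of simplices and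
  keeps cardinalities.\<close>

lemma elementary_collapse_image:
  assumes "elementary_collapse K L" and f: "inj_on f (\<Union>K)"
  shows "elementary_collapse ((\<lambda>\<sigma>. f ` \<sigma>) ` K) ((\<lambda>\<sigma>. f ` \<sigma>) ` L)"
proof -
  obtain \<sigma> \<tau> where K: "fin_complex K" "\<sigma> \<in> K" "\<tau> \<in> K" "\<sigma> \<noteq> {}" "\<sigma> \<subset> \<tau>" "card \<tau> = card \<sigma> + 1"
      "\<And>\<rho>. \<rho> \<in> K \<Longrightarrow> \<sigma> \<subset> \<rho> \<Longrightarrow> \<rho> = \<tau>" and L: "L = K - {\<sigma>, \<tau>}"
    using assms unfolding elementary_collapse_def by blast
  have sub: "\<rho> \<in> K \<Longrightarrow> \<rho>' \<in> K \<Longrightarrow> f ` \<rho> \<subseteq> f ` \<rho>' \<longleftrightarrow> \<rho> \<subseteq> \<rho>'" for \<rho> \<rho>'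
    using inj_on_image_subset_cancel[OF f] by (simp add: Union_upper)
  have eq: "\<rho> \<in> K \<Longrightarrow> \<rho>' \<in> K \<Longrightarrow> f ` \<rho> = f ` \<rho>' \<longleftrightarrow> \<rho> = \<rho>'" for \<rho> \<rho>'
    using inj_on_image_eq_iff[OF f] by (simp add: Union_upper)
  have card: "\<rho> \<in> K \<Longrightarrow> card (f ` \<rho>) = card \<rho>" for \<rho>
    by (meson Union_upper card_image f inj_on_subset)
  show ?thesis
  proof (rule elementary_collapseI)
    show "fin_complex ((\<lambda>\<sigma>. f ` \<sigma>) ` K)"
      using K(1) by (rule fin_complex_image)
    show "f ` \<sigma> \<in> (\<lambda>\<sigma>. f ` \<sigma>) ` K" "f ` \<tau> \<in> (\<lambda>\<sigma>. f ` \<sigma>) ` K" "f ` \<sigma> \<noteq> {}"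
      "card (f ` \<tau>) = card (f ` \<sigma>) + 1"
      using K(2-4,6) card by auto
    show "f ` \<sigma> \<subset> f ` \<tau>"
      using K(5) sub[OF K(2,3)] eq[OF K(2,3)] by (simp add: psubset_eq)
    show "\<rho> = f ` \<tau>" if \<rho>: "\<rho> \<in> (\<lambda>\<sigma>. f ` \<sigma>) ` K" "f ` \<sigma> \<subset> \<rho>" for \<rho>
    proof -
      obtain \<rho>' where "\<rho>' \<in> K" "\<rho> = f ` \<rho>'"
        using \<rho>(1) by blast
      moreover from this have "\<sigma> \<subset> \<rho>'"
        using \<rho>(2) sub[OF K(2)] by (auto simp: psubset_eq)
      ultimately show ?thesis
        using K(7) by blast
    qed
    show "(\<lambda>\<sigma>. f ` \<sigma>) ` L = (\<lambda>\<sigma>. f ` \<sigma>) ` K - {f ` \<sigma>, f ` \<tau>}"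
      unfolding L using eq K(2,3) by auto
  qed
qed

lemma same_type_elementary_collapse:
  assumes "elementary_collapse (K :: 'a set set) L" "fin_complex L"
  shows "same_simple_homotopy_type K L"
proof -
  have K: "fin_complex K" "L \<subseteq> K"
    using assms by (auto simp: elementary_collapse_def)
  obtain f :: "'a \<Rightarrow> nat" where f: "inj_on f (\<Union>K)"
    using complex_iso_nat[OF K(1)] .
  moreover have "inj_on f (\<Union>L)"
    using f K(2) by (meson Union_mono inj_on_subset)
  ultimately have "complex_iso K ((\<lambda>\<sigma>. f ` \<sigma>) ` K)" "complex_iso L ((\<lambda>\<sigma>. f ` \<sigma>) ` L)"
    by (auto simp: complex_iso_def)
  moreover have "simple_homotopy_move\<^sup>*\<^sup>* ((\<lambda>\<sigma>. f ` \<sigma>) ` K) ((\<lambda>\<sigma>. f ` \<sigma>) ` L)"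
    using elementary_collapse_image[OF assms(1) f] by (simp add: simple_homotopy_move_def r_into_rtranclp)
  ultimately show ?thesis
    unfolding same_simple_homotopy_type_def using K(1) assms(2) by blast
qed

text \<open>Removing a simplex of maximal dimension outside \<open>L\<close> together with its partner is an elementary
  collapse, because maximality forces the larger one of the two to contain \<open>t\<close>.\<close>

lemma same_type_toggle:
  assumes "fin_complex K" "fin_complex L" "L \<subseteq> K"
    and "\<And>\<sigma>. \<sigma> \<in> K - L \<Longrightarrow> insert t \<sigma> \<in> K - L \<and> \<sigma> - {t} \<in> K - L"
  shows "same_simple_homotopy_type K L"
  using assms
proof (induction "card (K - L)" arbitrary: K rule: less_induct)
  case (less K)
  note toggle = less.prems(4)
  have fin: "finite K" "finite (K - L)" "\<sigma> \<in> K \<Longrightarrow> finite \<sigma>" for \<sigma>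
    using less.prems(1) by (auto simp: fin_complex_def)
  show ?case
  proof (cases "K = L")
    case True
    then show ?thesis
      using less.prems(1) by (simp add: same_type_refl)
  next
    case False
    then have "K - L \<noteq> {}"
      using less.prems(3) by blast
    then have "Max (card ` (K - L)) \<in> card ` (K - L)"
      using fin(2) by (intro Max_in) auto
    then obtain \<tau> where \<tau>: "\<tau> \<in> K - L" and "card \<tau> = Max (card ` (K - L))"
      by auto
    then have max: "card \<rho> \<le> card \<tau>" if "\<rho> \<in> K - L" for \<rho>
      using fin(2) that by simp
    have mem: "t \<in> \<rho>" if "\<rho> \<in> K - L" "card \<rho> = card \<tau>" for \<rho>
    proof (rule ccontr)
      assume "t \<notin> \<rho>"
      then have "card (insert t \<rho>) = Suc (card \<rho>)"
        using that fin(3) by (simp add: card_insert_if)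
      then show False
        using max[of "insert t \<rho>"] toggle that by fastforce
    qed
    define \<sigma> where "\<sigma> = \<tau> - {t}"
    have \<sigma>: "\<sigma> \<in> K - L"
      using toggle \<tau> by (simp add: \<sigma>_def)
    have t: "t \<in> \<tau>" "t \<notin> \<sigma>" "\<tau> = insert t \<sigma>"
      using mem[OF \<tau>] by (auto simp: \<sigma>_def)
    have card: "card \<tau> = card \<sigma> + 1"
      using t \<sigma> fin(3) by (simp add: card_insert_if)
    \<comment> \<open>A simplex above \<open>\<sigma>\<close> cannot lie in the subcomplex
      \<open>L\<close>; being larger than \<open>\<sigma>\<close>, it has the maximal size and
      therefore contains \<open>t\<close> too.\<close>
    have unique: "\<rho> = \<tau>" if \<rho>: "\<rho> \<in> K" "\<sigma> \<subset> \<rho>" for \<rho>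
    proof -
      have "\<rho> \<notin> L"
        using \<sigma> \<rho> less.prems(2) unfolding fin_complex_def by blast
      then have \<rho>': "\<rho> \<in> K - L"
        using \<rho> by simp
      have "card \<sigma> < card \<rho>"
        using \<rho> fin(3) by (simp add: psubset_card_mono)
      then have *: "card \<rho> = card \<tau>"
        using max[OF \<rho>'] card by simp
      then have "\<tau> \<subseteq> \<rho>"
        using mem[OF \<rho>'] \<rho> t by blast
      then show "\<rho> = \<tau>"
        using * fin(3) \<rho>(1) by (metis card_subset_eq)
    qed
    define K' where "K' = K - {\<sigma>, \<tau>}"
    have "\<sigma> \<noteq> {}"
      using \<sigma> less.prems(2) by (auto simp: fin_complex_def)
    have K': "fin_complex K'"
    proof -
      have "\<rho>' \<in> K'" if "\<rho> \<in> K'" "\<rho>' \<subseteq> \<rho>" for \<rho> \<rho>'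
      proof -
        have "\<rho>' \<in> K"
          using that less.prems(1) by (auto simp: fin_complex_def K'_def)
        moreover have "\<rho> \<in> K" "\<rho> \<noteq> \<sigma>" "\<rho> \<noteq> \<tau>"
          using that by (auto simp: K'_def)
        then have "\<not> \<sigma> \<subseteq> \<rho>"
          using unique by blast
        then have "\<rho>' \<noteq> \<sigma>" "\<rho>' \<noteq> \<tau>"
          using that(2) t(3) by blast+
        ultimately show ?thesis
          by (simp add: K'_def)
      qed
      moreover have "{} \<in> K'"
        using less.prems(1) \<open>\<sigma> \<noteq> {}\<close> t by (auto simp: fin_complex_def K'_def)
      moreover have "finite K'" "\<And>\<rho>. \<rho> \<in> K' \<Longrightarrow> finite \<rho>"
        using fin by (auto simp: K'_def)
      ultimately show ?thesis
        unfolding fin_complex_def by blast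
    qed
    have "elementary_collapse K K'"
    proof (rule elementary_collapseI)
      show "fin_complex K" "\<sigma> \<noteq> {}" "card \<tau> = card \<sigma> + 1" "K' = K - {\<sigma>, \<tau>}"
        by fact+
      show "\<sigma> \<in> K" "\<tau> \<in> K" "\<sigma> \<subset> \<tau>"
        using \<sigma> \<tau> t by auto
    qed (rule unique)
    then have "same_simple_homotopy_type K K'"
      using K' by (rule same_type_elementary_collapse)
    moreover have "same_simple_homotopy_type K' L"
    proof (rule less.hyps)
      show "card (K' - L) < card (K - L)"
        using \<sigma> fin(2) by (intro psubset_card_mono) (auto simp: K'_def)
      show "fin_complex K'" "fin_complex L"
        using K' less.prems(2) by auto
      show "L \<subseteq> K'"
        using less.prems(3) \<sigma> \<tau> by (auto simp: K'_def)
      \<comment> \<open>\<open>\<sigma>\<close> and \<open>\<tau>\<close> are toggles of each other,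
        so what is left after removing both is still closed under toggling \<open>t\<close>.\<close>
      show "insert t \<rho> \<in> K' - L \<and> \<rho> - {t} \<in> K' - L" if \<rho>: "\<rho> \<in> K' - L" for \<rho>
      proof -
        have "insert t \<rho> \<in> K - L" "\<rho> - {t} \<in> K - L" "\<rho> \<noteq> \<sigma>" "\<rho> \<noteq> \<tau>"
          using \<rho> toggle by (auto simp: K'_def)
        moreover have "insert t \<rho> \<noteq> \<sigma>" "\<rho> - {t} \<noteq> \<tau>" "insert t \<rho> \<noteq> \<tau>" "\<rho> - {t} \<noteq> \<sigma>"
          using t \<open>\<rho> \<noteq> \<sigma>\<close> \<open>\<rho> \<noteq> \<tau>\<close> by auto
        ultimately show ?thesis
          by (simp add: K'_def)
      qed
    qed
    ultimately show ?thesis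
      by (rule same_type_trans)
  qed
qed

section \<open>Complexes given by forbidden sets\<close>

text \<open>The members of \<open>F\<close> are prescribed non-faces of any size: a pair acts as an
  edge, a singleton deletes a vertex as a loop does. All stages of the deformation then have the
  same format.\<close>

definition free_complex :: "'a set \<Rightarrow> 'a set set \<Rightarrow> 'a set set" where
  "free_complex V F = {\<sigma>. \<sigma> \<subseteq> V \<and> (\<forall>f\<in>F. \<not> f \<subseteq> \<sigma>)}"

lemma fin_complex_free: "finite V \<Longrightarrow> {} \<notin> F \<Longrightarrow> fin_complex (free_complex V F)"
  by (auto simp: fin_complex_def free_complex_def intro: finite_subset)

text \<open>The simplices containing some \<open>s\<close> in \<open>S\<close> are paired by
  toggling \<open>t\<close>. Removing \<open>t\<close> keeps \<open>s\<close>, because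
  \<open>t \<notin> s\<close>. Adding \<open>t\<close> could only complete some \<open>f\<close>
  with \<open>t \<in> f\<close>, but then \<open>ex\<close> yields a forbidden set inside the
  simplex already. For edges, \<open>ex\<close> holds when every neighbour of \<open>t\<close> is
  adjacent to a point of \<open>s\<close>. All of \<open>S\<close> is treated at once since the
  pairing depends on \<open>t\<close> alone.\<close>

lemma same_type_forbid:
  assumes "finite V" "{} \<notin> F" "{} \<notin> S" "t \<in> V"
    and t: "\<And>s. s \<in> S \<Longrightarrow> t \<notin> s"
    and ex: "\<And>s f. s \<in> S \<Longrightarrow> f \<in> F \<Longrightarrow> t \<in> f \<Longrightarrow> \<exists>g\<in>F. g \<subseteq> s \<union> (f - {t})"
  shows "same_simple_homotopy_type (free_complex V F) (free_complex V (F \<union> S))"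
proof (rule same_type_toggle)
  show "fin_complex (free_complex V F)" "fin_complex (free_complex V (F \<union> S))"
    using assms by (auto intro!: fin_complex_free)
  show "free_complex V (F \<union> S) \<subseteq> free_complex V F"
    by (auto simp: free_complex_def)
  fix \<sigma>
  assume "\<sigma> \<in> free_complex V F - free_complex V (F \<union> S)"
  then obtain s where s: "s \<in> S" "s \<subseteq> \<sigma>" and \<sigma>: "\<sigma> \<subseteq> V" "\<And>f. f \<in> F \<Longrightarrow> \<not> f \<subseteq> \<sigma>"
    by (auto simp: free_complex_def)
  have "\<not> f \<subseteq> insert t \<sigma>" if fF: "f \<in> F" for f
  proof
    assume f: "f \<subseteq> insert t \<sigma>"
    then have "t \<in> f"
      using \<sigma>(2)[OF fF] by blast
    then obtain g where "g \<in> F" "g \<subseteq> s \<union> (f - {t})"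
      using ex[OF s(1) fF] by blast
    then show False
      using \<sigma>(2) s(2) f by blast
  qed
  moreover have "s \<subseteq> \<sigma> - {t}" "s \<subseteq> insert t \<sigma>"
    using s t by auto
  moreover have "\<not> f \<subseteq> \<sigma> - {t}" if "f \<in> F" for f
    using \<sigma>(2)[OF that] by blast
  ultimately show "insert t \<sigma> \<in> free_complex V F - free_complex V (F \<union> S) \<and>
      \<sigma> - {t} \<in> free_complex V F - free_complex V (F \<union> S)"
    using \<sigma> s(1) \<open>t \<in> V\<close> by (auto simp: free_complex_def)
qed

lemma free_complex_image:
  assumes h: "inj_on h V" and F: "\<And>f. f \<in> F \<Longrightarrow> f \<subseteq> V"
  shows "free_complex (h ` V) ((\<lambda>f. h ` f) ` F) = (\<lambda>\<sigma>. h ` \<sigma>) ` free_complex V F"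
proof -
  have "h ` f \<subseteq> h ` \<sigma> \<longleftrightarrow> f \<subseteq> \<sigma>" if "f \<in> F" "\<sigma> \<subseteq> V" for f \<sigma>
    using inj_on_image_subset_cancel[OF h F[OF that(1)] that(2)] .
  then have "(\<forall>f\<in>(\<lambda>f. h ` f) ` F. \<not> f \<subseteq> h ` \<sigma>) \<longleftrightarrow> (\<forall>f\<in>F. \<not> f \<subseteq> \<sigma>)" if "\<sigma> \<subseteq> V" for \<sigma>
    using that by simp
  then have *: "h ` \<sigma> \<in> free_complex (h ` V) ((\<lambda>f. h ` f) ` F) \<longleftrightarrow> \<sigma> \<in> free_complex V F" if "\<sigma> \<subseteq> V" for \<sigma>
    using that by (simp add: free_complex_def image_mono)
  show ?thesis
  proof (intro equalityI subsetI)
    fix \<tau> assume \<tau>: "\<tau> \<in> free_complex (h ` V) ((\<lambda>f. h ` f) ` F)"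
    then obtain \<sigma> where "\<sigma> \<subseteq> V" "\<tau> = h ` \<sigma>"
      by (auto simp: free_complex_def subset_image_iff)
    then show "\<tau> \<in> (\<lambda>\<sigma>. h ` \<sigma>) ` free_complex V F"
      using * \<tau> by simp
  next
    fix \<tau> assume "\<tau> \<in> (\<lambda>\<sigma>. h ` \<sigma>) ` free_complex V F"
    then obtain \<sigma> where "\<sigma> \<in> free_complex V F" "\<tau> = h ` \<sigma>"
      by blast
    moreover from this have "\<sigma> \<subseteq> V"
      by (simp add: free_complex_def)
    ultimately show "\<tau> \<in> free_complex (h ` V) ((\<lambda>f. h ` f) ` F)"
      using * by simp
  qed
qed

section \<open>Wedges of cross-polytopes\<close>

text \<open>The boundary of an edge consists of the sets missing one of its two points, so a simplex
  of the join chooses at most one point from each of \<open>N + 1\<close> antipodal pairs.\<close>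

lemma diamond_free:
  "diamond N = free_complex ({0..N} \<times> {0, 1}) {{(i, 0), (i, 1)} |i. i \<le> N}"
proof -
  have s: "\<sigma> \<in> simplex_boundary 1 \<longleftrightarrow> \<sigma> \<subseteq> {0, 1} \<and> \<not> {0, 1} \<subseteq> \<sigma>" for \<sigma>
    by (auto simp: simplex_boundary_def numeral_eq_Suc atLeastAtMostSuc_conv)
  show ?thesis
  proof (intro equalityI subsetI)
    fix \<sigma> assume "\<sigma> \<in> diamond N"
    then show "\<sigma> \<in> free_complex ({0..N} \<times> {0, 1}) {{(i, 0), (i, 1)} |i. i \<le> N}"
      unfolding diamond_def join_def free_complex_def s by fastforce
  next
    fix \<sigma> :: "(nat \<times> nat) set" assume \<sigma>: "\<sigma> \<in> free_complex ({0..N} \<times> {0, 1}) {{(i, 0), (i, 1)} |i. i \<le> N}"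
    then have "\<sigma> = Sigma {0..N} (\<lambda>i. \<sigma> `` {i})"
      by (auto simp: free_complex_def)
    moreover have "\<sigma> `` {i} \<in> simplex_boundary 1" if "i \<in> {0..N}" for i
    proof -
      have "\<not> {(i, 0), (i, 1)} \<subseteq> \<sigma>" "\<sigma> \<subseteq> {0..N} \<times> {0, 1}"
        using \<sigma> that by (auto simp: free_complex_def)
      then show ?thesis
        unfolding s by auto
    qed
    ultimately show "\<sigma> \<in> diamond N"
      unfolding diamond_def join_def by blast
  qed
qed

lemma Union_diamond: "\<Union>(diamond N) \<subseteq> {0..N} \<times> {0, 1}"
  by (auto simp: diamond_free free_complex_def)

text \<open>Recognises a wedge inside a common vertex set: the maps \<open>h j\<close> embed copies
  of \<open>K\<close> that meet only in \<open>c\<close>. Applying \<open>disj\<close> also with the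
  two copies exchanged puts both preimages at the chosen vertices.\<close>

lemma complex_iso_wedge:
  assumes inj: "\<And>j. j < r \<Longrightarrow> inj_on (h j) (\<Union>K)"
    and base: "\<And>j. j < r \<Longrightarrow> h j (b j) = c" and b: "\<And>j. j < r \<Longrightarrow> b j \<in> \<Union>K"
    and disj: "\<And>j j' v v'. j < r \<Longrightarrow> j' < r \<Longrightarrow> j \<noteq> j' \<Longrightarrow> v \<in> \<Union>K \<Longrightarrow> v' \<in> \<Union>K \<Longrightarrow>
       h j v = h j' v' \<Longrightarrow> v = b j"
  shows "complex_iso (wedge r K b) {h j ` \<sigma> |j \<sigma>. j < r \<and> \<sigma> \<in> K}"
proof -
  \<comment> \<open>\<open>None\<close> is the wedge point and goes to \<open>c\<close>; elsewhere
    the copy index selects the embedding.\<close>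
  define f where "f = case_option c (\<lambda>(j, v). h j v)"
  have f: "f (wedge_vertex b (j, v)) = h j v" if "j < r" for j v
    using base[OF that] by (auto simp: f_def wedge_vertex_def)
  have "v \<in> \<Union>(wedge r K b) \<Longrightarrow> \<exists>j x. j < r \<and> x \<in> \<Union>K \<and> v = wedge_vertex b (j, x)" for v
    by (auto simp: wedge_def)
  moreover have "wedge_vertex b (j, x) = wedge_vertex b (j', x')"
    if "j < r" "j' < r" "x \<in> \<Union>K" "x' \<in> \<Union>K" "h j x = h j' x'" for j j' x x'
  proof (cases "j = j'")
    case True
    then show ?thesis
      using inj[of j] that by (auto dest: inj_onD)
  next
    case False
    then show ?thesis
      using disj[of j j' x x'] disj[of j' j x' x] that by (simp add: wedge_vertex_def)
  qed
  ultimately have "inj_on f (\<Union>(wedge r K b))"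
    unfolding inj_on_def using f by metis
  moreover have "{h j ` \<sigma> |j \<sigma>. j < r \<and> \<sigma> \<in> K} = (\<lambda>\<sigma>. f ` \<sigma>) ` wedge r K b"
  proof -
    have image: "f ` wedge_vertex b ` ({j} \<times> \<sigma>) = h j ` \<sigma>" if "j < r" for j \<sigma>
      using f[OF that] by (auto simp: image_image image_iff)
    have "wedge r K b = (\<lambda>(j, \<sigma>). wedge_vertex b ` ({j} \<times> \<sigma>)) ` ({..<r} \<times> K)"
      by (auto simp: wedge_def)
    then have "(\<lambda>\<sigma>. f ` \<sigma>) ` wedge r K b = (\<lambda>(j, \<sigma>). f ` wedge_vertex b ` ({j} \<times> \<sigma>)) ` ({..<r} \<times> K)"
      by (simp only: image_image case_prod_unfold)
    also have "\<dots> = (\<lambda>(j, \<sigma>). h j ` \<sigma>) ` ({..<r} \<times> K)"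
    proof (rule image_cong[OF refl])
      fix p assume "p \<in> {..<r} \<times> K"
      then have "fst p < r"
        by auto
      then show "(case p of (j, \<sigma>) \<Rightarrow> f ` wedge_vertex b ` ({j} \<times> \<sigma>)) = (case p of (j, \<sigma>) \<Rightarrow> h j ` \<sigma>)"
        by (simp only: case_prod_unfold image)
    qed
    finally show ?thesis
      by auto
  qed
  ultimately show ?thesis
    unfolding complex_iso_def by blast
qed

text \<open>The wedge points are arbitrary in the theorem, so vertex transitivity is needed:
  exchange the factors \<open>i\<close> and \<open>i'\<close>, and for \<open>e \<noteq> e'\<close>
  swap the two points of every factor. Both operations preserve the antipodal pairs.\<close>

lemma diamond_automorphism:
  assumes "{v} \<in> diamond N" "{w} \<in> diamond N"
  obtains \<alpha> where "inj_on \<alpha> ({0..N} \<times> {0, 1})" "(\<lambda>\<sigma>. \<alpha> ` \<sigma>) ` diamond N = diamond N" "\<alpha> v = w"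
proof -
  let ?V = "{0..N} \<times> {0, 1 :: nat}"
  obtain i e i' e' where v: "v = (i, e)" "i \<le> N" "e \<in> {0, 1}" and w: "w = (i', e')" "i' \<le> N" "e' \<in> {0, 1}"
    using assms by (auto simp: diamond_free free_complex_def)
  define \<pi> where "\<pi> = id(i := i', i' := i)"
  define \<epsilon> where "\<epsilon> x = (if e = e' then x else 1 - x)" for x :: nat
  define \<alpha> where "\<alpha> = map_prod \<pi> \<epsilon>"
  have \<pi>: "inj_on \<pi> {0..N}" "\<pi> ` {0..N} = {0..N}"
    using v w by (auto simp: \<pi>_def inj_on_def image_iff)
  have \<epsilon>: "inj_on \<epsilon> {0, 1}" "\<epsilon> ` {0, 1} = {0, 1}"
    by (auto simp: \<epsilon>_def)
  have inj: "inj_on \<alpha> ?V"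
    using \<pi>(1) \<epsilon>(1) unfolding \<alpha>_def by (rule map_prod_inj_on)
  have "\<alpha> ` ?V = ?V"
    unfolding \<alpha>_def map_prod_surj_on[OF \<pi>(2) \<epsilon>(2)] ..
  moreover have "(\<lambda>f. \<alpha> ` f) ` {{(i, 0), (i, 1)} |i. i \<le> N} = {{(i, 0), (i, 1)} |i. i \<le> N}"
  proof -
    have "(\<lambda>f. \<alpha> ` f) ` {{(i, 0), (i, 1)} |i. i \<le> N} = (\<lambda>i. {(\<pi> i, 0), (\<pi> i, 1)}) ` {0..N}"
    proof -
      have "\<alpha> ` {(i, 0), (i, 1)} = {(\<pi> i, 0), (\<pi> i, 1)}" for i
        using \<epsilon>(2) by (auto simp: \<alpha>_def \<epsilon>_def)
      moreover have "{{(i, 0), (i, 1 :: nat)} |i. i \<le> N} = (\<lambda>i. {(i, 0), (i, 1)}) ` {0..N}"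
        by auto
      ultimately show ?thesis
        by (simp add: image_image)
    qed
    also have "\<dots> = (\<lambda>i. {(i, 0), (i, 1)}) ` \<pi> ` {0..N}"
      by (simp add: image_image)
    finally show ?thesis
      unfolding \<pi>(2) by auto
  qed
  moreover have "(\<lambda>\<sigma>. \<alpha> ` \<sigma>) ` free_complex ?V {{(i, 0), (i, 1)} |i. i \<le> N} =
      free_complex (\<alpha> ` ?V) ((\<lambda>f. \<alpha> ` f) ` {{(i, 0), (i, 1)} |i. i \<le> N})"
    by (rule free_complex_image[OF inj, symmetric]) auto
  ultimately have "(\<lambda>\<sigma>. \<alpha> ` \<sigma>) ` diamond N = diamond N"
    by (simp only: diamond_free)
  moreover have "\<alpha> v = w"
    using v w by (auto simp: \<alpha>_def \<pi>_def \<epsilon>_def)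
  ultimately show thesis
    using that inj by blast
qed

section \<open>The ring of hexagons\<close>

text \<open>\<open>Rung True j\<close>, \<open>Rung False j\<close>, \<open>Mid True j\<close>, \<open>Mid False j\<close> are the vertices \<open>x\<^sub>j\<close>, \<open>y\<^sub>j\<close>, \<open>u\<^sub>j\<close>, \<open>v\<^sub>j\<close>;
  they lie in the columns \<open>2 * j - 1\<close> and \<open>2 * j\<close> of the cylinder.\<close>

datatype site = Rung bool nat | Mid bool nat

definition ring_sites :: "nat \<Rightarrow> site set" where
  "ring_sites n = {Rung r j |r j. 1 \<le> j \<and> j \<le> n} \<union> {Mid r j |r j. 1 \<le> j \<and> j \<le> n}"

text \<open>Only endpoint sets are recorded, since parallel edges do not affect independence. For
  \<open>n = 1\<close> the second family coincides with the first, which reflects the doubled edges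
  of a cylinder with two columns.\<close>

definition ring_edges :: "nat \<Rightarrow> site set set" where
  "ring_edges n = {{Rung r j, Mid r j} |r j. 1 \<le> j \<and> j \<le> n} \<union>
     {{Mid r j, Rung r (if j = n then 1 else j + 1)} |r j. 1 \<le> j \<and> j \<le> n} \<union>
     {{Rung True j, Rung False j} |j. 1 \<le> j \<and> j \<le> n}"

lemma mem_ring_sites [simp]:
  "Rung r j \<in> ring_sites n \<longleftrightarrow> 1 \<le> j \<and> j \<le> n" "Mid r j \<in> ring_sites n \<longleftrightarrow> 1 \<le> j \<and> j \<le> n"
  by (auto simp: ring_sites_def)

lemma finite_ring_sites: "finite (ring_sites n)"
proof -
  have "ring_sites n = case_prod Rung ` (UNIV \<times> {1..n}) \<union> case_prod Mid ` (UNIV \<times> {1..n})"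
    by (auto simp: ring_sites_def)
  then show ?thesis
    by simp
qed

lemma ring_edges_subset: "f \<in> ring_edges n \<Longrightarrow> f \<subseteq> ring_sites n"
  by (auto simp: ring_edges_def ring_sites_def)

lemma empty_ring_edges: "{} \<notin> ring_edges n"
  by (auto simp: ring_edges_def)

lemma ring_edge_rung: "1 \<le> j \<Longrightarrow> j \<le> n \<Longrightarrow> {Rung r j, Rung (\<not> r) j} \<in> ring_edges n"
  by (cases r) (auto simp: ring_edges_def insert_commute)

lemma ring_edge_mid: "1 \<le> j \<Longrightarrow> j \<le> n \<Longrightarrow> {Rung r j, Mid r j} \<in> ring_edges n"
  by (auto simp: ring_edges_def)

lemma ring_edge_next: "1 \<le> j \<Longrightarrow> j < n \<Longrightarrow> {Mid r j, Rung r (Suc j)} \<in> ring_edges n"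
  unfolding ring_edges_def
  by (intro UnI1 UnI2 CollectI exI[of _ r] exI[of _ j]) auto

lemma ring_edge_last: "1 \<le> n \<Longrightarrow> {Mid r n, Rung r 1} \<in> ring_edges n"
  unfolding ring_edges_def
  by (intro UnI1 UnI2 CollectI exI[of _ r] exI[of _ n]) auto

text \<open>All toggled vertices are of this kind, so \<open>same_type_forbid\<close> meets just two
  ring edges at each of them.\<close>

lemma ring_edges_at_mid:
  assumes "f \<in> ring_edges n" "Mid r j \<in> f"
  shows "f = {Rung r j, Mid r j} \<or> f = {Mid r j, Rung r (if j = n then 1 else Suc j)}"
  using assms unfolding ring_edges_def by (auto simp: insert_commute)

text \<open>The sets forbidden during a run around the ring. \<open>X\<close> is \<open>{x\<^sub>1}\<close> or \<open>{x\<^sub>n}\<close> when edges are added at that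
  vertex, and \<open>{}\<close> when vertices are deleted. The entries with index \<open>j + 1\<close> are forbidden by toggling
  \<open>Mid (\<rho> j) j\<close>, one of whose neighbours was dealt with at index \<open>j\<close>.\<close>

definition zigzag :: "(nat \<Rightarrow> bool) \<Rightarrow> nat \<Rightarrow> site set \<Rightarrow> site set set" where
  "zigzag \<rho> m X = (\<lambda>z. insert z X) ` (\<Union>j\<in>{2..m}. {Rung (\<rho> j) j, Mid (\<not> \<rho> j) j})"

lemma zigzag_rung: "2 \<le> j \<Longrightarrow> j \<le> m \<Longrightarrow> insert (Rung (\<rho> j) j) X \<in> zigzag \<rho> m X"
  by (auto simp: zigzag_def)

lemma zigzag_mid: "2 \<le> j \<Longrightarrow> j \<le> m \<Longrightarrow> r \<noteq> \<rho> j \<Longrightarrow> insert (Mid r j) X \<in> zigzag \<rho> m X"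
  unfolding zigzag_def by (intro imageI UN_I[of j]) auto

lemma zigzagE:
  assumes "f \<in> zigzag \<rho> m X"
  obtains z j where "f = insert z X" "2 \<le> j" "j \<le> m" "z = Rung (\<rho> j) j \<or> z = Mid (\<not> \<rho> j) j"
  using assms by (auto simp: zigzag_def)

lemma ring_edgesE:
  assumes "f \<in> ring_edges n"
  obtains r j where "f = {Rung r j, Mid r j}" "1 \<le> j" "j \<le> n"
    | r j where "f = {Mid r j, Rung r (if j = n then 1 else j + 1)}" "1 \<le> j" "j \<le> n"
    | j where "f = {Rung True j, Rung False j}" "1 \<le> j" "j \<le> n"
  using assms unfolding ring_edges_def by (elim UnE CollectE exE conjE) simp_all

lemma zigzag_trivial: "m < 2 \<Longrightarrow> zigzag \<rho> m X = {}"
  by (auto simp: zigzag_def)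

text \<open>Each round toggles \<open>Mid (\<rho> m) m\<close> and adds both entries of index
  \<open>m + 1\<close>. Of its two neighbours, the rung vertex of index \<open>m\<close> already
  contains a forbidden set together with \<open>X\<close>, by \<open>base\<close> or by the previous
  round, and the one of index \<open>m + 1\<close> is adjacent to both new entries. The assumption
  \<open>ex\<close> handles the sets of \<open>F\<close> at the toggled vertex that are not ring
  edges.\<close>

lemma same_type_zigzag:
  assumes F: "ring_edges n \<subseteq> F" "{} \<notin> F" and "m \<le> n"
    and \<rho>: "\<And>j. \<rho> (Suc j) = (\<not> \<rho> j)"
    and base: "\<exists>g\<in>F. g \<subseteq> insert (Rung (\<rho> 1) 1) X"
    and X: "\<And>j. 1 \<le> j \<Longrightarrow> j < m \<Longrightarrow> Mid (\<rho> j) j \<notin> X"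
    and ex: "\<And>j f. 1 \<le> j \<Longrightarrow> j < m \<Longrightarrow> f \<in> F - ring_edges n \<Longrightarrow> Mid (\<rho> j) j \<in> f \<Longrightarrow>
       \<exists>g\<in>F. g \<subseteq> X \<union> (f - {Mid (\<rho> j) j})"
  shows "same_simple_homotopy_type (free_complex (ring_sites n) F)
           (free_complex (ring_sites n) (F \<union> zigzag \<rho> m X))"
  using \<open>m \<le> n\<close> X ex
proof (induction m)
  case 0
  then show ?case
    using F(2) by (simp add: zigzag_trivial same_type_refl fin_complex_free finite_ring_sites)
next
  case (Suc m)
  have IH: "same_simple_homotopy_type (free_complex (ring_sites n) F)
      (free_complex (ring_sites n) (F \<union> zigzag \<rho> m X))"
    using Suc.prems by (intro Suc.IH) auto
  show ?case
  proof (cases "m = 0")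
    case True
    then show ?thesis
      using F(2) by (simp add: zigzag_trivial same_type_refl fin_complex_free finite_ring_sites)
  next
    case False
    define t where "t = Mid (\<rho> m) m"
    define S where "S = {insert (Rung (\<not> \<rho> m) (Suc m)) X, insert (Mid (\<rho> m) (Suc m)) X}"
    have m: "1 \<le> m" "m < Suc m" "m < n"
      using False Suc.prems(1) by auto
    have tX: "t \<notin> X"
      using Suc.prems(2)[OF m(1,2)] by (simp add: t_def)
    have "same_simple_homotopy_type (free_complex (ring_sites n) (F \<union> zigzag \<rho> m X))
        (free_complex (ring_sites n) ((F \<union> zigzag \<rho> m X) \<union> S))"
    proof (rule same_type_forbid[OF finite_ring_sites])
      show "{} \<notin> F \<union> zigzag \<rho> m X" "{} \<notin> S"
        using F(2) by (auto simp: zigzag_def S_def)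
      show "t \<in> ring_sites n"
        using m by (auto simp: t_def ring_sites_def)
      show "t \<notin> s" if "s \<in> S" for s
        using that tX by (auto simp: S_def t_def)
      fix s f
      assume s: "s \<in> S" and f: "f \<in> F \<union> zigzag \<rho> m X" and t: "t \<in> f"
      \<comment> \<open>Apart from \<open>X\<close>, earlier rounds use middle vertices of the row
        \<open>\<not> \<rho> j\<close> only, hence add nothing at \<open>t\<close>.\<close>
      have "f \<notin> zigzag \<rho> m X"
        using t tX by (auto simp: zigzag_def t_def)
      then have fF: "f \<in> F"
        using f by blast
      have Xs: "X \<subseteq> s"
        using s by (auto simp: S_def)
      consider "f \<notin> ring_edges n" | "f = {Rung (\<rho> m) m, t}" | "f = {t, Rung (\<rho> m) (Suc m)}"
        using ring_edges_at_mid[of f n "\<rho> m" m] t m by (auto simp: t_def)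
      then show "\<exists>g\<in>F \<union> zigzag \<rho> m X. g \<subseteq> s \<union> (f - {t})"
      proof cases
        case 1
        then obtain g where "g \<in> F" "g \<subseteq> X \<union> (f - {t})"
          using Suc.prems(3)[of m f] m fF t by (auto simp: t_def)
        then show ?thesis
          using Xs by blast
      next
        case 2
        have *: "\<exists>g\<in>F \<union> zigzag \<rho> m X. g \<subseteq> insert (Rung (\<rho> m) m) X"
        proof (cases "m = 1")
          case True
          then show ?thesis
            using base by blast
        next
          case False
          then show ?thesis
            using m zigzag_rung[of m m \<rho> X] by auto
        qed
        have "insert (Rung (\<rho> m) m) X \<subseteq> s \<union> (f - {t})"
          using Xs 2 by (auto simp: t_def)
        then show ?thesis
          using * subset_trans by (elim bexE) (intro bexI)
      next
        case 3
        obtain z where z: "z \<in> s" "z = Rung (\<not> \<rho> m) (Suc m) \<or> z = Mid (\<rho> m) (Suc m)"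
          using s by (auto simp: S_def)
        \<comment> \<open>The new entry \<open>z\<close> lies across the rung or next along the
          row.\<close>
        have "{Rung (\<rho> m) (Suc m), z} \<in> F"
          using F(1) m z(2) ring_edge_rung[of "Suc m" n "\<rho> m"] ring_edge_mid[of "Suc m" n "\<rho> m"] by auto
        then show ?thesis
          using 3 z(1) by (intro bexI[of _ "{Rung (\<rho> m) (Suc m), z}"]) (auto simp: t_def)
      qed
    qed
    \<comment> \<open>\<open>\<rho>\<close> flips between \<open>m\<close> and \<open>m + 1\<close>,
      so \<open>S\<close> is precisely the layer of index \<open>m + 1\<close>.\<close>
    moreover have "zigzag \<rho> (Suc m) X = zigzag \<rho> m X \<union> S"
      using m by (simp add: zigzag_def S_def atLeastAtMostSuc_conv \<rho> insert_commute)
    ultimately show ?thesis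
      using same_type_trans[OF IH] by (simp add: Un_assoc)
  qed
qed

section \<open>Odd length\<close>

lemma same_type_ring_odd:
  assumes "odd n"
  shows "same_simple_homotopy_type (free_complex (ring_sites n) (ring_edges n)) point_complex"
proof -
  let ?V = "ring_sites n"
  let ?x = "Rung True 1" and ?u = "Mid True n" and ?v = "Mid False n"
  have n: "1 \<le> n"
    using assms by (simp add: odd_pos Suc_leI)
  \<comment> \<open>\<open>F1\<close> attaches edges at x_1, \<open>F2\<close> deletes x_1,
    \<open>F3\<close> deletes vertices along the second run, and \<open>F4\<close> shrinks the
    remaining cone to its apex u_n.\<close>
  define F1 where "F1 = ring_edges n \<union> zigzag even n {?x}"
  define F2 where "F2 = F1 \<union> {{?x}}"
  define F3 where "F3 = F2 \<union> zigzag odd n {}"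
  define F4 where "F4 = F3 \<union> {{z} |z. z \<in> ?V - {?u}}"
  have ne: "{} \<notin> F1" "{} \<notin> F2" "{} \<notin> F3"
    using empty_ring_edges[of n] by (auto simp: F1_def F2_def F3_def zigzag_def)
  have x: "{?x} \<in> F2" "{?x} \<in> F3"
    by (auto simp: F2_def F3_def)
  have "same_simple_homotopy_type (free_complex ?V (ring_edges n)) (free_complex ?V F1)"
    unfolding F1_def
  proof (rule same_type_zigzag)
    show "\<exists>g\<in>ring_edges n. g \<subseteq> insert (Rung (even (1 :: nat)) 1) {?x}"
      using ring_edge_rung[of 1 n True] n by (intro bexI[of _ "{?x, Rung False 1}"]) auto
  qed (use empty_ring_edges in auto)
  moreover have "same_simple_homotopy_type (free_complex ?V F1) (free_complex ?V F2)"
    unfolding F2_def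
  proof (rule same_type_forbid[OF finite_ring_sites ne(1), of _ ?v])
    show "?v \<in> ?V"
      using n by (auto simp: ring_sites_def)
    fix s f assume s: "s \<in> {{?x}}" and f: "f \<in> F1" "?v \<in> f"
    \<comment> \<open>For odd \<open>n\<close> the middle vertex of index \<open>n\<close> in the
      run can only be u_n, so v_n still has nothing but its ring edges.\<close>
    have "f \<in> ring_edges n"
      using f assms by (auto simp: F1_def zigzag_def)
    then consider "f = {Rung False n, ?v}" | "f = {?v, Rung False 1}"
      using ring_edges_at_mid[of f n False n] f by auto
    then show "\<exists>g\<in>F1. g \<subseteq> s \<union> (f - {?v})"
    proof cases
      case 1
      have "{?x, Rung False n} \<in> F1"
        using ring_edge_rung[of 1 n True] zigzag_rung[of n n even "{?x}"] n assms
        by (cases "n = 1") (auto simp: F1_def insert_commute)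
      then show ?thesis
        using 1 s by (intro bexI[of _ "{?x, Rung False n}"]) auto
    next
      case 2
      then show ?thesis
        using ring_edge_rung[of 1 n True] s n by (intro bexI[of _ "{?x, Rung False 1}"]) (auto simp: F1_def)
    qed
  qed auto
  moreover have "same_simple_homotopy_type (free_complex ?V F2) (free_complex ?V F3)"
    unfolding F3_def
  proof (rule same_type_zigzag)
    show "\<exists>g\<in>F2. g \<subseteq> insert (Rung (odd (1 :: nat)) 1) {}"
      using x by (intro bexI[of _ "{?x}"]) auto
    \<comment> \<open>Every forbidden set that is not a ring edge contains x_1, and {x_1} itself is
      forbidden by now.\<close>
    fix j f assume "f \<in> F2 - ring_edges n" "Mid (odd j) j \<in> f"
    then have "?x \<in> f"
      by (auto simp: F2_def F1_def zigzag_def)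
    then show "\<exists>g\<in>F2. g \<subseteq> {} \<union> (f - {Mid (odd j) j})"
      using x by (intro bexI[of _ "{?x}"]) auto
  qed (use ne in \<open>auto simp: F1_def F2_def\<close>)
  moreover have "same_simple_homotopy_type (free_complex ?V F3) (free_complex ?V F4)"
    unfolding F4_def
  proof (rule same_type_forbid[OF finite_ring_sites ne(3), of _ ?u])
    show "?u \<in> ?V"
      using n by (auto simp: ring_sites_def)
    fix s f assume f: "f \<in> F3" "?u \<in> f"
    \<comment> \<open>As \<open>n\<close> is odd, the deleting run ends at x_n (which is x_1 for
      \<open>n = 1\<close>). So u_n has lost both neighbours and is the apex of a cone.\<close>
    have xn: "{Rung True n} \<in> F3"
      using x n assms zigzag_rung[of n n odd "{}"] by (cases "n = 1") (auto simp: F3_def)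
    have "f \<in> ring_edges n \<or> ?x \<in> f"
      using f assms by (auto simp: F1_def F2_def F3_def zigzag_def)
    then consider "Rung True n \<in> f" | "?x \<in> f"
      using ring_edges_at_mid[of f n True n] f by auto
    then show "\<exists>g\<in>F3. g \<subseteq> s \<union> (f - {?u})"
    proof cases
      case 1
      then show ?thesis
        using xn by (intro bexI[of _ "{Rung True n}"]) auto
    next
      case 2
      then show ?thesis
        using x by (intro bexI[of _ "{?x}"]) auto
    qed
  qed auto
  ultimately have *: "same_simple_homotopy_type (free_complex ?V (ring_edges n)) (free_complex ?V F4)"
    using same_type_trans by blast
  \<comment> \<open>The deleting run takes u_j for even \<open>j\<close> and v_j for odd
    \<open>j\<close>, so u_n survives.\<close>
  have F4: "\<not> f \<subseteq> {?u}" if f: "f \<in> F4" for f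
  proof
    assume "f \<subseteq> {?u}"
    moreover have "f \<noteq> {}"
      using f ne(3) by (auto simp: F4_def)
    ultimately have "f = {?u}"
      by blast
    then show False
      using f assms by (auto simp: F1_def F2_def F3_def F4_def zigzag_def ring_edges_def)
  qed
  have free: "free_complex ?V F4 = {{}, {?u}}"
  proof (intro equalityI subsetI)
    fix \<sigma> assume \<sigma>: "\<sigma> \<in> free_complex ?V F4"
    have "\<sigma> \<subseteq> {?u}"
    proof
      fix z assume "z \<in> \<sigma>"
      then have "z \<in> ?V" "{z} \<notin> F4"
        using \<sigma> by (auto simp: free_complex_def)
      then show "z \<in> {?u}"
        by (auto simp: F4_def)
    qed
    then show "\<sigma> \<in> {{}, {?u}}"
      by blast
  next
    fix \<sigma> assume "\<sigma> \<in> {{}, {?u}}"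
    then have "\<sigma> \<subseteq> {?u}"
      by blast
    moreover have "?u \<in> ?V"
      using n by (auto simp: ring_sites_def)
    ultimately show "\<sigma> \<in> free_complex ?V F4"
      using F4 by (auto simp: free_complex_def)
  qed
  then have "complex_iso (free_complex ?V F4) point_complex"
    by (auto simp: complex_iso_def point_complex_def)
  then have "same_simple_homotopy_type (free_complex ?V F4) point_complex"
    using * by (intro same_type_iso) (auto simp: same_simple_homotopy_type_def)
  then show ?thesis
    using * same_type_trans by blast
qed

section \<open>Even length\<close>

text \<open>For \<open>even\<close> and \<open>odd\<close> these are complementary halves of the
  ring; each takes from every index one rung vertex and the middle vertex of the other row.\<close>

definition sphere_sites :: "(nat \<Rightarrow> bool) \<Rightarrow> nat \<Rightarrow> site set" where
  "sphere_sites \<rho> n = {Rung (\<rho> j) j |j. 1 \<le> j \<and> j \<le> n} \<union> {Mid (\<not> \<rho> j) j |j. 1 \<le> j \<and> j \<le> n}"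

definition outer :: "nat \<Rightarrow> site set" where
  "outer n = sphere_sites even n - {Mid True (n - 1)}"

text \<open>x_1 is left out because the first run already joins it to the outer sphere, and u_n
  because it becomes the wedge point.\<close>

definition inner :: "nat \<Rightarrow> site set" where
  "inner n = sphere_sites odd n - {Rung True 1, Mid True n}"

text \<open>The families stand in the order in which they are forbidden. The run at x_n stops at
  \<open>n - 1\<close>: for even \<open>n\<close> its entries of index \<open>n\<close> would be
  {y_n, x_n} and {u_n, x_n}, which are ring edges.\<close>

definition even_faces :: "nat \<Rightarrow> site set set" where
  "even_faces n = ring_edges n \<union> zigzag even n {Rung True 1} \<union> {{Mid True (n - 1)}} \<union>
     {{Rung True n, Mid False 1}} \<union> zigzag odd (n - 1) {Rung True n} \<union>
     {{a, q} |a q. a \<in> outer n \<and> q \<in> inner n}"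

lemma mem_sphere_sites [simp]:
  "Rung r j \<in> sphere_sites \<rho> n \<longleftrightarrow> 1 \<le> j \<and> j \<le> n \<and> r = \<rho> j"
  "Mid r j \<in> sphere_sites \<rho> n \<longleftrightarrow> 1 \<le> j \<and> j \<le> n \<and> r = (\<not> \<rho> j)"
  by (auto simp: sphere_sites_def)

section \<open>Joining the outer sphere to the inner one\<close>

lemma ring_sites_split: "ring_sites n = sphere_sites even n \<union> sphere_sites odd n"
  unfolding ring_sites_def sphere_sites_def by fastforce

text \<open>Index 1 contributes the ring neighbours y_1 and u_1 of x_1; all later indices come from
  the run at x_1.\<close>

lemma face_first_rung:
  assumes "a \<in> sphere_sites even n"
  shows "{Rung True 1, a} \<in> ring_edges n \<union> zigzag even n {Rung True 1}"
proof -
  obtain j where a: "a = Rung (even j) j \<or> a = Mid (odd j) j" and j: "1 \<le> j" "j \<le> n"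
    using assms by (auto simp: sphere_sites_def)
  have "a = Rung False 1 \<or> a = Mid True 1" if "j = 1"
    using a that by auto
  moreover have "{Rung True 1, Rung False 1} \<in> ring_edges n" "{Rung True 1, Mid True 1} \<in> ring_edges n"
    using j ring_edge_rung[of 1 n True] ring_edge_mid[of 1 n True] by auto
  moreover have "{Rung True 1, a} \<in> zigzag even n {Rung True 1}" if "j \<noteq> 1"
    using a j that zigzag_rung[of j n even "{Rung True 1}"] zigzag_mid[of j n "odd j" even "{Rung True 1}"]
    by (auto simp: insert_commute)
  ultimately show ?thesis
    by blast
qed

lemma even_facesE:
  assumes "f \<in> even_faces n"
  obtains "f \<in> ring_edges n" | "f \<in> zigzag even n {Rung True 1}" | "f = {Mid True (n - 1)}"
    | "f = {Rung True n, Mid False 1}" | "f \<in> zigzag odd (n - 1) {Rung True n}"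
    | a q where "f = {a, q}" "a \<in> outer n" "q \<in> inner n"
  using assms unfolding even_faces_def by (elim UnE CollectE exE conjE singletonE) metis+

lemma same_type_ring_even:
  assumes "even n" "2 \<le> n"
  shows "same_simple_homotopy_type (free_complex (ring_sites n) (ring_edges n))
           (free_complex (ring_sites n) (even_faces n))"
proof -
  let ?V = "ring_sites n"
  let ?x = "Rung True 1" and ?xn = "Rung True n" and ?u = "Mid True n" and ?v = "Mid False n"
  have n: "1 \<le> n" "even n" "odd (n - 1)" "1 \<le> n - 1" "n - 1 \<noteq> n"
    using assms by auto
  define F1 where "F1 = ring_edges n \<union> zigzag even n {?x}"
  define F2 where "F2 = F1 \<union> {{Mid True (n - 1)}}"
  define F3 where "F3 = F2 \<union> {{?xn, Mid False 1}}"
  define F4 where "F4 = F3 \<union> zigzag odd (n - 1) {?xn}"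
  define S where "S = {{a, q} |a q. a \<in> outer n \<and> q \<in> inner n}"
  have ne: "{} \<notin> F1" "{} \<notin> F2" "{} \<notin> F3" "{} \<notin> F4"
    using empty_ring_edges[of n] by (auto simp: F1_def F2_def F3_def F4_def zigzag_def)
  have sub: "ring_edges n \<subseteq> F1" "F1 \<subseteq> F2" "F2 \<subseteq> F3" "F3 \<subseteq> F4"
    by (auto simp: F1_def F2_def F3_def F4_def)
  have xxn: "{?x, ?xn} \<in> F1"
    using zigzag_rung[of n n even "{?x}"] assms by (simp add: F1_def insert_commute)
  have x_face: "{?x, a} \<in> F1" if "a \<in> sphere_sites even n" for a
    unfolding F1_def using that by (rule face_first_rung)
  have "same_simple_homotopy_type (free_complex ?V (ring_edges n)) (free_complex ?V F1)"
    unfolding F1_def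
  proof (rule same_type_zigzag)
    show "\<exists>g\<in>ring_edges n. g \<subseteq> insert (Rung (even (1 :: nat)) 1) {?x}"
      using ring_edge_rung[of 1 n True] n by (intro bexI[of _ "{?x, Rung False 1}"]) auto
  qed (use empty_ring_edges in auto)
  moreover have "same_simple_homotopy_type (free_complex ?V F1) (free_complex ?V F2)"
    unfolding F2_def
  proof (rule same_type_forbid[OF finite_ring_sites ne(1), of _ ?u])
    show "?u \<in> ?V"
      using n by (auto simp: ring_sites_def)
    fix s f assume s: "s \<in> {{Mid True (n - 1)}}"
    then show "?u \<notin> s"
      using n by auto
    assume f: "f \<in> F1" "?u \<in> f"
    \<comment> \<open>For even \<open>n\<close> the first run contains v_n and not u_n. So u_n has
      only the neighbours x_n and x_1, both adjacent to u_(n-1).\<close>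
    have "f \<in> ring_edges n"
      using f n by (auto simp: F1_def zigzag_def)
    then consider "f = {?xn, ?u}" | "f = {?u, ?x}"
      using ring_edges_at_mid[of f n True n] f by auto
    then show "\<exists>g\<in>F1. g \<subseteq> s \<union> (f - {?u})"
    proof cases
      case 1
      have "{Mid True (n - 1), ?xn} \<in> F1"
        using ring_edge_next[of "n - 1" n True] n sub(1) by auto
      then show ?thesis
        using 1 s by (intro bexI[of _ "{Mid True (n - 1), ?xn}"]) auto
    next
      case 2
      have "Mid True (n - 1) \<in> sphere_sites even n"
        using n by simp
      then show ?thesis
        using 2 x_face s by (intro bexI[of _ "{?x, Mid True (n - 1)}"]) auto
    qed
  qed auto
  \<comment> \<open>A run starts at index 2, so {x_n, v_1} is added separately by toggling v_n. Its
    ring neighbours y_n and y_1 are adjacent to x_n and v_1, and its further neighbour x_1 is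
    adjacent to x_n.\<close>
  moreover have "same_simple_homotopy_type (free_complex ?V F2) (free_complex ?V F3)"
    unfolding F3_def
  proof (rule same_type_forbid[OF finite_ring_sites ne(2), of _ ?v])
    show "?v \<in> ?V"
      using n by (auto simp: ring_sites_def)
    fix s f assume s: "s \<in> {{?xn, Mid False 1}}"
    then show "?v \<notin> s"
      using assms by auto
    assume f: "f \<in> F2" "?v \<in> f"
    have "f \<in> ring_edges n \<or> ?x \<in> f"
      using f n by (auto simp: F1_def F2_def zigzag_def)
    then consider "f = {Rung False n, ?v}" | "f = {?v, Rung False 1}" | "?x \<in> f"
      using ring_edges_at_mid[of f n False n] f by auto
    then show "\<exists>g\<in>F2. g \<subseteq> s \<union> (f - {?v})"
    proof cases
      case 1
      then show ?thesis
        using ring_edge_rung[of n n True] s n sub by (intro bexI[of _ "{?xn, Rung False n}"]) auto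
    next
      case 2
      then show ?thesis
        using ring_edge_mid[of 1 n False] s n sub by (intro bexI[of _ "{Rung False 1, Mid False 1}"]) auto
    next
      case 3
      then show ?thesis
        using xxn s sub by (intro bexI[of _ "{?x, ?xn}"]) auto
    qed
  qed auto
  moreover have "same_simple_homotopy_type (free_complex ?V F3) (free_complex ?V F4)"
    unfolding F4_def
  proof (rule same_type_zigzag)
    show "\<exists>g\<in>F3. g \<subseteq> insert (Rung (odd (1 :: nat)) 1) {?xn}"
      using xxn sub by (intro bexI[of _ "{?x, ?xn}"]) auto
    \<comment> \<open>The bound \<open>j < n - 1\<close> keeps u_(n-1) from being toggled, and
      parity keeps v_1; all other new sets at the toggled vertex pass through x_1.\<close>
    fix j f assume j: "1 \<le> j" "j < n - 1" and f: "f \<in> F3 - ring_edges n" "Mid (odd j) j \<in> f"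
    then have "?x \<in> f"
      by (auto simp: F3_def F2_def F1_def zigzag_def)
    then show "\<exists>g\<in>F3. g \<subseteq> {?xn} \<union> (f - {Mid (odd j) j})"
      using xxn sub by (intro bexI[of _ "{?x, ?xn}"]) auto
  qed (use ne sub in auto)
  \<comment> \<open>By now x_n is adjacent to all of \<open>inner n\<close> and x_1 to all of
    \<open>outer n\<close>. These are the neighbours of u_n, so toggling u_n forbids every pair in
    \<open>S\<close> at once.\<close>
  moreover have "same_simple_homotopy_type (free_complex ?V F4) (free_complex ?V (F4 \<union> S))"
  proof (rule same_type_forbid[OF finite_ring_sites ne(4), of _ ?u])
    show "?u \<in> ?V" "{} \<notin> S"
      using n by (auto simp: ring_sites_def S_def)
    fix s f assume "s \<in> S"
    then obtain a q where s: "s = {a, q}" "a \<in> outer n" "q \<in> inner n"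
      by (auto simp: S_def)
    then show "?u \<notin> s"
      using n by (auto simp: outer_def inner_def sphere_sites_def)
    assume f: "f \<in> F4" "?u \<in> f"
    have "f \<in> ring_edges n"
      using f n by (auto simp: F1_def F2_def F3_def F4_def zigzag_def)
    then consider "f = {?xn, ?u}" | "f = {?u, ?x}"
      using ring_edges_at_mid[of f n True n] f by auto
    then show "\<exists>g\<in>F4. g \<subseteq> s \<union> (f - {?u})"
    proof cases
      case 1
      \<comment> \<open>y_n is reached by its rung, v_1 by the edge added in \<open>F3\<close>, the
        rest by the run at x_n.\<close>
      have "{q, ?xn} \<in> F4"
      proof -
        from s(3) have q: "q \<noteq> ?x" "q \<noteq> ?u"
          by (auto simp: inner_def)
        from s(3) consider j where "q = Rung (odd j) j" "1 \<le> j" "j \<le> n"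
          | j where "q = Mid (even j) j" "1 \<le> j" "j \<le> n"
          by (auto simp: inner_def sphere_sites_def)
        then show ?thesis
        proof cases
          case (1 j)
          have "j \<noteq> 1"
            using 1(1) q(1) by auto
          then have "2 \<le> j"
            using 1(2) by simp
          show ?thesis
          proof (cases "j = n")
            case True
            then show ?thesis
              using 1 ring_edge_rung[of n n False] n sub by auto
          next
            case False
            then have "j \<le> n - 1"
              using 1(3) by simp
            then show ?thesis
              using zigzag_rung[OF \<open>2 \<le> j\<close>, of "n - 1" odd "{?xn}"] 1(1) by (simp add: F4_def)
          qed
        next
          case (2 j)
          have "j \<noteq> n"
            using 2(1) q(2) n by auto
          then have "j \<le> n - 1"
            using 2(3) by simp
          show ?thesis
          proof (cases "j = 1")
            case True
            then show ?thesis
              using 2(1) by (simp add: F4_def F3_def insert_commute)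
          next
            case False
            then have "2 \<le> j"
              using 2(2) by simp
            then show ?thesis
              using zigzag_mid[OF _ \<open>j \<le> n - 1\<close>, of "even j" odd "{?xn}"] 2(1) by (simp add: F4_def)
          qed
        qed
      qed
      then show ?thesis
        using 1 s by (intro bexI[of _ "{q, ?xn}"]) auto
    next
      case 2
      have "{?x, a} \<in> F4"
        using s(2) x_face[of a] sub unfolding outer_def by blast
      then show ?thesis
        using 2 s by (intro bexI[of _ "{?x, a}"]) auto
    qed
  qed
  moreover have "F4 \<union> S = even_faces n"
    unfolding even_faces_def F4_def F3_def F2_def F1_def S_def ..
  ultimately show ?thesis
    using same_type_trans by metis
qed

text \<open>\<open>(i, 0)\<close> and \<open>(i, 1)\<close> are antipodal, with \<open>i\<close>
  counted from 0 and sites from 1. The usual partner of the rung vertex \<open>i + 1\<close> is the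
  middle vertex \<open>i\<close> of its row. At \<open>i = 0\<close> this wraps around to v_n, and
  at \<open>i = n - 1\<close> the deleted u_(n-1) is replaced by u_n.\<close>

fun outer_site :: "nat \<Rightarrow> nat \<times> nat \<Rightarrow> site" where
  "outer_site n (i, e) =
     (if e = 0 then Rung (odd i) (Suc i)
      else if Suc i = n then Mid True n else if i = 0 then Mid False n else Mid (odd i) i)"

fun inner_site :: "nat \<Rightarrow> nat \<times> nat \<Rightarrow> site" where
  "inner_site n (i, e) =
     (if e = 0 then Rung (even i) (Suc i) else if i = 0 then Mid True n else Mid (even i) i)"

lemma inj_outer_site: "inj_on (outer_site n) ({0..n - 1} \<times> {0, 1})"
  by (auto simp: inj_on_def split: if_splits)

lemma inj_inner_site: "1 \<le> n \<Longrightarrow> inj_on (inner_site n) ({0..n - 1} \<times> {0, 1})"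
  by (auto simp: inj_on_def split: if_splits)

lemma image_outer_site:
  assumes "even n" "2 \<le> n"
  shows "outer_site n ` ({0..n - 1} \<times> {0, 1}) = insert (Mid True n) (outer n)"
proof (intro equalityI subsetI)
  fix z assume "z \<in> outer_site n ` ({0..n - 1} \<times> {0, 1})"
  then obtain v where v: "z = outer_site n v" "v \<in> {0..n - 1} \<times> {0, 1}"
    by (rule imageE)
  obtain i e where "v = (i, e)"
    by (cases v)
  with v have z: "i \<le> n - 1" "e = 0 \<or> e = 1" "z = outer_site n (i, e)"
    by auto
  have "Rung (even (Suc i)) (Suc i) \<in> outer n"
    using z(1) assms by (simp add: outer_def)
  moreover have "Mid (odd i) i \<in> outer n" if "i \<noteq> 0" "Suc i \<noteq> n"
    using z(1) that by (auto simp: outer_def)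
  moreover have "Mid False n \<in> outer n"
    using assms by (simp add: outer_def)
  ultimately show "z \<in> insert (Mid True n) (outer n)"
    using z by auto
next
  fix z assume "z \<in> insert (Mid True n) (outer n)"
  then consider "z = Mid True n" | j where "z = Rung (even j) j" "1 \<le> j" "j \<le> n"
    | j where "z = Mid (odd j) j" "1 \<le> j" "j \<le> n" "z \<noteq> Mid True (n - 1)"
    by (auto simp: outer_def sphere_sites_def)
  then obtain i e where "i \<le> n - 1" "e = 0 \<or> e = 1" "z = outer_site n (i, e)"
  proof cases
    case 1
    then show ?thesis
      using assms that[of "n - 1" 1] by auto
  next
    case (2 j)
    then show ?thesis
      using assms that[of "j - 1" 0] by auto
  next
    case (3 j)
    show ?thesis
    proof (cases "j = n")
      case True
      then show ?thesis
        using 3 assms that[of 0 1] by auto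
    next
      case False
      moreover have "Suc j \<noteq> n"
        using 3(1,4) assms(1) by auto
      ultimately show ?thesis
        using 3(1,2,3) that[of j 1] by auto
    qed
  qed
  then show "z \<in> outer_site n ` ({0..n - 1} \<times> {0, 1})"
    by (intro image_eqI[of _ _ "(i, e)"]) auto
qed

lemma image_inner_site:
  assumes "even n" "2 \<le> n"
  shows "inner_site n ` ({0..n - 1} \<times> {0, 1}) = sphere_sites odd n"
proof (intro equalityI subsetI)
  fix z assume "z \<in> inner_site n ` ({0..n - 1} \<times> {0, 1})"
  then obtain v where v: "z = inner_site n v" "v \<in> {0..n - 1} \<times> {0, 1}"
    by (rule imageE)
  obtain i e where "v = (i, e)"
    by (cases v)
  with v have z: "i \<le> n - 1" "e = 0 \<or> e = 1" "z = inner_site n (i, e)"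
    by auto
  have "Rung (odd (Suc i)) (Suc i) \<in> sphere_sites odd n"
    using z(1) assms by simp
  moreover have "Mid (even i) i \<in> sphere_sites odd n" if "i \<noteq> 0"
    using z(1) that by auto
  moreover have "Mid True n \<in> sphere_sites odd n"
    using assms by simp
  ultimately show "z \<in> sphere_sites odd n"
    using z by auto
next
  fix z assume "z \<in> sphere_sites odd n"
  then consider j where "z = Rung (odd j) j" "1 \<le> j" "j \<le> n"
    | j where "z = Mid (even j) j" "1 \<le> j" "j \<le> n"
    by (auto simp: sphere_sites_def)
  then obtain i e where "i \<le> n - 1" "e = 0 \<or> e = 1" "z = inner_site n (i, e)"
  proof cases
    case (1 j)
    then show ?thesis
      using assms that[of "j - 1" 0] by auto
  next
    case (2 j)
    then show ?thesis
      using assms that[of 0 1] that[of j 1] by (cases "j = n") auto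
  qed
  then show "z \<in> inner_site n ` ({0..n - 1} \<times> {0, 1})"
    by (intro image_eqI[of _ _ "(i, e)"]) auto
qed

section \<open>The final complex as a union of two cross-polytopes\<close>

lemma outer_pair_edge:
  assumes "even n" "2 \<le> n" "i \<le> n - 1"
  shows "{outer_site n (i, 0), outer_site n (i, 1)} \<in> ring_edges n"
  using assms ring_edge_mid[of n n True] ring_edge_last[of n False] ring_edge_next[of i n "odd i"]
  by (auto simp: insert_commute)

lemma inner_pair_edge:
  assumes "even n" "2 \<le> n" "i \<le> n - 1"
  shows "{inner_site n (i, 0), inner_site n (i, 1)} \<in> ring_edges n"
  using assms ring_edge_last[of n True] ring_edge_next[of i n "even i"]
  by (auto simp: insert_commute)

text \<open>Every added family contains a point off the outer sphere: x_1, u_(n-1), v_1, an entry of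
  the run at x_n, or an inner vertex. Among the ring edges, parity leaves only the antipodal
  pairs.\<close>

lemma even_faces_outer:
  assumes "even n" "2 \<le> n" "f \<in> even_faces n" "f \<subseteq> insert (Mid True n) (outer n)"
  shows "\<exists>i\<le>n - 1. f = {outer_site n (i, 0), outer_site n (i, 1)}"
proof -
  have rung: "r = even j" if "Rung r j \<in> insert (Mid True n) (outer n)" for r j
    using that by (auto simp: outer_def sphere_sites_def)
  have mid: "j = n \<or> (r = odd j \<and> Suc j \<noteq> n)" if "Mid r j \<in> insert (Mid True n) (outer n)" for r j
    using that assms(1,2) by (auto simp: outer_def sphere_sites_def)
  have inner: "q \<notin> insert (Mid True n) (outer n)" if "q \<in> inner n" for q
    using that assms(1) by (auto simp: outer_def inner_def sphere_sites_def)
  have "Rung True 1 \<notin> f" "Mid True (n - 1) \<notin> f" "Mid False 1 \<notin> f"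
    using assms rung[of True 1] mid[of True "n - 1"] mid[of False 1] by auto
  have *: "f \<notin> zigzag odd (n - 1) {Rung True n}"
  proof
    assume "f \<in> zigzag odd (n - 1) {Rung True n}"
    then obtain z j where "f = insert z {Rung True n}"
        and z: "j \<le> n - 1" "z = Rung (odd j) j \<or> z = Mid (\<not> odd j) j" "2 \<le> j"
      by (rule zigzagE)
    then have "z \<in> insert (Mid True n) (outer n)"
      using assms(4) by blast
    then show False
      using z rung[of "odd j" j] mid[of "even j" j] assms(2) by auto
  qed
  have **: "f \<notin> zigzag even n {Rung True 1}"
    using \<open>Rung True 1 \<notin> f\<close> by (auto elim: zigzagE)
  have ***: "f \<noteq> {Mid True (n - 1)}" "f \<noteq> {Rung True n, Mid False 1}"
    using \<open>Mid True (n - 1) \<notin> f\<close> \<open>Mid False 1 \<notin> f\<close> by auto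
  have pair: "f \<noteq> {a, q}" if "q \<in> inner n" for a q
    using inner[OF that] assms(4) by auto
  from assms(3) have "f \<in> ring_edges n"
  proof (cases rule: even_facesE)
    case 2
    with ** show ?thesis by contradiction
  next
    case 3
    with ***(1) show ?thesis by contradiction
  next
    case 4
    with ***(2) show ?thesis by contradiction
  next
    case 5
    with * show ?thesis by contradiction
  next
    case (6 a q)
    from pair[OF 6(3), of a] 6(1) show ?thesis by contradiction
  qed
  then show ?thesis
  proof (cases rule: ring_edgesE)
    case (1 r j)
    \<comment> \<open>Within one index the parities of rung and middle vertex clash, except for the
      exceptional vertex u_n.\<close>
    then have "j = n" "r"
      using assms rung[of r j] mid[of r j] by auto
    then show ?thesis
      using 1 assms by (intro exI[of _ "n - 1"]) auto
  next
    case (2 r j)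
    show ?thesis
    proof (cases "j = n")
      case True
      then have "\<not> r"
        using 2 assms(4) rung[of r 1] by auto
      then show ?thesis
        using 2 True assms by (intro exI[of _ 0]) auto
    next
      case False
      then have "r = odd j" "Suc j \<noteq> n"
        using 2 assms(4) rung[of r "j + 1"] mid[of r j] by auto
      then show ?thesis
        using 2 False assms by (intro exI[of _ j]) auto
    qed
  next
    case (3 j)
    then show ?thesis
      using assms(4) rung[of True j] rung[of False j] by auto
  qed
qed

text \<open>The points off this sphere are now an entry of the run at x_1, u_(n-1), x_n, or an outer
  vertex. The ring edges left over run from a middle vertex to the next rung.\<close>

lemma even_faces_inner:
  assumes "even n" "2 \<le> n" "f \<in> even_faces n" "f \<subseteq> sphere_sites odd n"
  shows "\<exists>i\<le>n - 1. f = {inner_site n (i, 0), inner_site n (i, 1)}"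
proof -
  have rung: "r = odd j" if "Rung r j \<in> sphere_sites odd n" for r j
    using that by (auto simp: sphere_sites_def)
  have mid: "r = even j" if "Mid r j \<in> sphere_sites odd n" for r j
    using that by (auto simp: sphere_sites_def)
  have outer: "a \<notin> sphere_sites odd n" if "a \<in> outer n" for a
    using that by (auto simp: outer_def sphere_sites_def)
  have "Rung True n \<notin> f" "Mid True (n - 1) \<notin> f"
    using assms rung[of True n] mid[of True "n - 1"] by auto
  have *: "f \<notin> zigzag even n {Rung True 1}"
  proof
    assume "f \<in> zigzag even n {Rung True 1}"
    then obtain z j where "f = insert z {Rung True 1}" and z: "z = Rung (even j) j \<or> z = Mid (\<not> even j) j"
      by (rule zigzagE)
    then have "z \<in> sphere_sites odd n"
      using assms(4) by blast
    then show False
      using z rung[of "even j" j] mid[of "odd j" j] by auto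
  qed
  have **: "f \<notin> zigzag odd (n - 1) {Rung True n}"
    using \<open>Rung True n \<notin> f\<close> by (auto elim: zigzagE)
  have ***: "f \<noteq> {Mid True (n - 1)}" "f \<noteq> {Rung True n, Mid False 1}"
    using \<open>Mid True (n - 1) \<notin> f\<close> \<open>Rung True n \<notin> f\<close> by auto
  have pair: "f \<noteq> {a, q}" if "a \<in> outer n" for a q
    using outer[OF that] assms(4) by auto
  from assms(3) have "f \<in> ring_edges n"
  proof (cases rule: even_facesE)
    case 2
    with * show ?thesis by contradiction
  next
    case 3
    with ***(1) show ?thesis by contradiction
  next
    case 4
    with ***(2) show ?thesis by contradiction
  next
    case 5
    with ** show ?thesis by contradiction
  next
    case (6 a q)
    from pair[OF 6(2), of q] 6(1) show ?thesis by contradiction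
  qed
  then show ?thesis
  proof (cases rule: ring_edgesE)
    case (1 r j)
    then have "Rung r j \<in> sphere_sites odd n" "Mid r j \<in> sphere_sites odd n"
      using assms(4) by blast+
    then have "r = odd j" "r = even j"
      using rung mid by blast+
    then show ?thesis
      by blast
  next
    case (2 r j)
    then have "Mid r j \<in> sphere_sites odd n"
      using assms(4) by blast
    then have "r = even j"
      by (rule mid)
    show ?thesis
    proof (cases "j = n")
      case True
      then show ?thesis
        using 2 \<open>r = even j\<close> assms(1,2) by (intro exI[of _ 0]) auto
    next
      case False
      then show ?thesis
        using 2 \<open>r = even j\<close> by (intro exI[of _ j]) auto
    qed
  next
    case (3 j)
    then have "True = odd j" "False = odd j"
      using assms(4) by (auto intro!: rung)
    then show ?thesis
      by blast
  qed
qed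

lemma free_even_faces:
  assumes "even n" "2 \<le> n"
  shows "free_complex (ring_sites n) (even_faces n) =
    (\<lambda>\<sigma>. outer_site n ` \<sigma>) ` diamond (n - 1) \<union> (\<lambda>\<sigma>. inner_site n ` \<sigma>) ` diamond (n - 1)"
proof -
  let ?P = "\<lambda>h. {{h (i, 0), h (i, 1)} |i. i \<le> n - 1} :: site set set"
  have pairs: "(\<lambda>f. h ` f) ` {{(i, 0), (i, 1)} |i. i \<le> n - 1} = ?P h" for h :: "nat \<times> nat \<Rightarrow> site"
    by (simp only: setcompr_eq_image image_image image_insert image_empty)
  have image: "(\<lambda>\<sigma>. h ` \<sigma>) ` diamond (n - 1) = free_complex (h ` ({0..n - 1} \<times> {0, 1})) (?P h)"
    if "inj_on h ({0..n - 1} \<times> {0, 1})" for h :: "nat \<times> nat \<Rightarrow> site"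
    unfolding diamond_free pairs[symmetric] by (rule free_complex_image[OF that, symmetric]) auto
  have outer: "(\<lambda>\<sigma>. outer_site n ` \<sigma>) ` diamond (n - 1) =
      free_complex (insert (Mid True n) (outer n)) (?P (outer_site n))"
    using image[OF inj_outer_site] image_outer_site[OF assms] by simp
  have inner: "(\<lambda>\<sigma>. inner_site n ` \<sigma>) ` diamond (n - 1) =
      free_complex (sphere_sites odd n) (?P (inner_site n))"
    using image[OF inj_inner_site] image_inner_site[OF assms] assms(2) by simp
  show ?thesis
    unfolding outer inner
  proof (intro equalityI subsetI)
    fix \<sigma> assume \<sigma>: "\<sigma> \<in> free_complex (ring_sites n) (even_faces n)"
    then have free: "\<not> f \<subseteq> \<sigma>" if "f \<in> even_faces n" for f
      using that by (auto simp: free_complex_def)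
    have edges: "ring_edges n \<subseteq> even_faces n"
      by (auto simp: even_faces_def)
    \<comment> \<open>A point of \<open>outer n\<close> excludes \<open>inner n\<close> and x_1, to
      which it is joined; u_(n-1) is excluded anyway. Without such a point only the odd half
      remains.\<close>
    have "\<sigma> \<subseteq> insert (Mid True n) (outer n) \<or> \<sigma> \<subseteq> sphere_sites odd n"
    proof (cases "\<sigma> \<inter> outer n = {}")
      case True
      have "{Mid True (n - 1)} \<in> even_faces n"
        by (simp add: even_faces_def)
      then have "Mid True (n - 1) \<notin> \<sigma>"
        using free by blast
      moreover have "\<sigma> \<subseteq> sphere_sites even n \<union> sphere_sites odd n"
        using \<sigma> by (auto simp: free_complex_def ring_sites_split)
      ultimately show ?thesis
        using True by (auto simp: outer_def)
    next
      case False
      then obtain a where a: "a \<in> \<sigma>" "a \<in> outer n"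
        by blast
      have "z \<in> insert (Mid True n) (outer n)" if z: "z \<in> \<sigma>" for z
      proof -
        have "{a, z} \<subseteq> \<sigma>"
          using a z by blast
        then have "{a, z} \<notin> even_faces n"
          using free by blast
        then have "z \<notin> inner n"
          using a by (auto simp: even_faces_def)
        moreover have "z \<noteq> Rung True 1"
          using \<open>{a, z} \<notin> even_faces n\<close> face_first_rung[of a n] a
          by (auto simp: even_faces_def outer_def insert_commute)
        moreover have "z \<noteq> Mid True (n - 1)"
        proof
          assume "z = Mid True (n - 1)"
          then have "{z} \<in> even_faces n"
            by (simp add: even_faces_def)
          then show False
            using free z by blast
        qed
        moreover have "z \<in> sphere_sites even n \<union> sphere_sites odd n"
          using \<sigma> z by (auto simp: free_complex_def ring_sites_split)
        ultimately show ?thesis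
          by (auto simp: outer_def inner_def)
      qed
      then show ?thesis
        by blast
    qed
    then show "\<sigma> \<in> free_complex (insert (Mid True n) (outer n)) (?P (outer_site n)) \<union>
        free_complex (sphere_sites odd n) (?P (inner_site n))"
      using free edges outer_pair_edge[OF assms] inner_pair_edge[OF assms]
      unfolding free_complex_def by blast
  next
    fix \<sigma> assume "\<sigma> \<in> free_complex (insert (Mid True n) (outer n)) (?P (outer_site n)) \<union>
        free_complex (sphere_sites odd n) (?P (inner_site n))"
    then consider
      (outer) "\<sigma> \<subseteq> insert (Mid True n) (outer n)"
        "\<And>i. i \<le> n - 1 \<Longrightarrow> \<not> {outer_site n (i, 0), outer_site n (i, 1)} \<subseteq> \<sigma>" |
      (inner) "\<sigma> \<subseteq> sphere_sites odd n"
        "\<And>i. i \<le> n - 1 \<Longrightarrow> \<not> {inner_site n (i, 0), inner_site n (i, 1)} \<subseteq> \<sigma>"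
      unfolding free_complex_def by blast
    then show "\<sigma> \<in> free_complex (ring_sites n) (even_faces n)"
    proof cases
      case outer
      have "\<not> f \<subseteq> \<sigma>" if "f \<in> even_faces n" for f
        using even_faces_outer[OF assms that] outer by blast
      moreover have "Mid True n \<in> ring_sites n"
        using assms by (auto simp: ring_sites_def)
      then have "\<sigma> \<subseteq> ring_sites n"
        using outer(1) by (auto simp: outer_def ring_sites_split)
      ultimately show ?thesis
        by (simp add: free_complex_def)
    next
      case inner
      have "\<not> f \<subseteq> \<sigma>" if "f \<in> even_faces n" for f
        using even_faces_inner[OF assms that] inner by blast
      moreover have "\<sigma> \<subseteq> ring_sites n"
        using inner(1) by (auto simp: ring_sites_split)
      ultimately show ?thesis
        by (simp add: free_complex_def)
    qed
  qed
qed

lemma same_type_ring_wedge: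
  assumes n: "even n" "2 \<le> n" and b: "\<And>j. j < 2 \<Longrightarrow> {b j} \<in> diamond (n - 1)"
  shows "same_simple_homotopy_type (free_complex (ring_sites n) (ring_edges n))
           (wedge 2 (diamond (n - 1)) b)"
proof -
  let ?K = "diamond (n - 1)" and ?u = "Mid True n"
  \<comment> \<open>These are the coordinates of u_n in the outer and in the inner sphere;
    \<open>\<alpha>\<close> and \<open>\<beta>\<close> move the prescribed wedge points
    there.\<close>
  have base: "{(n - 1, 1)} \<in> ?K" "{(0, 1)} \<in> ?K"
    by (auto simp: diamond_free free_complex_def)
  obtain \<alpha> where \<alpha>: "inj_on \<alpha> ({0..n - 1} \<times> {0, 1})" "(\<lambda>\<sigma>. \<alpha> ` \<sigma>) ` ?K = ?K" "\<alpha> (b 0) = (n - 1, 1)"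
    using diamond_automorphism[OF b[of 0] base(1)] by auto
  obtain \<beta> where \<beta>: "inj_on \<beta> ({0..n - 1} \<times> {0, 1})" "(\<lambda>\<sigma>. \<beta> ` \<sigma>) ` ?K = ?K" "\<beta> (b 1) = (0, 1)"
    using diamond_automorphism[OF b[of 1] base(2)] by auto
  define h where "h j = (if j = 0 then outer_site n \<circ> \<alpha> else inner_site n \<circ> \<beta>)" for j :: nat
  have U: "\<Union>?K \<subseteq> {0..n - 1} \<times> {0, 1}"
    by (rule Union_diamond)
  have \<alpha>U: "\<alpha> ` \<Union>?K = \<Union>?K" and \<beta>U: "\<beta> ` \<Union>?K = \<Union>?K"
    using \<alpha>(2) \<beta>(2) by (metis image_Union)+
  have inj0: "inj_on (h 0) (\<Union>?K)"
    unfolding h_def using \<alpha>(1) inj_outer_site[of n] U \<alpha>U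
    by (auto intro!: comp_inj_on intro: inj_on_subset)
  have inj1: "inj_on (h 1) (\<Union>?K)"
    unfolding h_def using \<beta>(1) inj_inner_site[of n] n(2) U \<beta>U
    by (auto intro!: comp_inj_on intro: inj_on_subset)
  have h0: "h 0 v \<in> insert ?u (outer n)" if "v \<in> \<Union>?K" for v
  proof -
    have "\<alpha> v \<in> {0..n - 1} \<times> {0, 1}"
      using that \<alpha>U U by blast
    then show ?thesis
      unfolding image_outer_site[OF n, symmetric] h_def by simp
  qed
  have h1: "h 1 v \<in> sphere_sites odd n" if "v \<in> \<Union>?K" for v
  proof -
    have "\<beta> v \<in> {0..n - 1} \<times> {0, 1}"
      using that \<beta>U U by blast
    then show ?thesis
      unfolding image_inner_site[OF n, symmetric] h_def by simp
  qed
  have hb: "h 0 (b 0) = ?u" "h 1 (b 1) = ?u"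
    using n \<alpha>(3) \<beta>(3) by (auto simp: h_def)
  have bU: "b j \<in> \<Union>?K" if "j < 2" for j
    using b[OF that] by blast
  \<comment> \<open>u_n is the only vertex shared by the two spheres.\<close>
  have meet: "h 0 v = ?u" if "v \<in> \<Union>?K" "v' \<in> \<Union>?K" "h 0 v = h 1 v'" for v v'
    using h0[OF that(1)] h1[OF that(2)] that(3) by (auto simp: outer_def sphere_sites_def)
  have two: "j < 2 \<longleftrightarrow> j = 0 \<or> j = 1" for j :: nat
    by auto
  have "complex_iso (wedge 2 ?K b) {h j ` \<sigma> |j \<sigma>. j < 2 \<and> \<sigma> \<in> ?K}"
  proof (rule complex_iso_wedge)
    show "inj_on (h j) (\<Union>?K)" "h j (b j) = ?u" "b j \<in> \<Union>?K" if "j < 2" for j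
      using that inj0 inj1 hb bU by (auto simp: less_2_cases_iff)
    fix j j' :: nat and v v'
    assume j: "j < 2" "j' < 2" "j \<noteq> j'" and v: "v \<in> \<Union>?K" "v' \<in> \<Union>?K" and eq: "h j v = h j' v'"
    consider "j = 0" "j' = 1" | "j = 1" "j' = 0"
      using j by (auto simp: less_2_cases_iff)
    then show "v = b j"
    proof cases
      case 1
      then have "h 0 v = h 0 (b 0)"
        using meet[OF v] eq hb(1) by simp
      then show ?thesis
        using inj_onD[OF inj0] v(1) bU[of 0] 1 by simp
    next
      case 2
      then have "h 1 v = h 1 (b 1)"
        using meet[OF v(2,1)] eq hb(2) by simp
      then show ?thesis
        using inj_onD[OF inj1] v(1) bU[of 1] 2 by simp
    qed
  qed
  moreover have "{h j ` \<sigma> |j \<sigma>. j < 2 \<and> \<sigma> \<in> ?K} = (\<lambda>\<sigma>. h 0 ` \<sigma>) ` ?K \<union> (\<lambda>\<sigma>. h 1 ` \<sigma>) ` ?K"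
    unfolding two by blast
  moreover have "(\<lambda>\<sigma>. h 0 ` \<sigma>) ` ?K = (\<lambda>\<sigma>. outer_site n ` \<sigma>) ` (\<lambda>\<sigma>. \<alpha> ` \<sigma>) ` ?K"
    "(\<lambda>\<sigma>. h 1 ` \<sigma>) ` ?K = (\<lambda>\<sigma>. inner_site n ` \<sigma>) ` (\<lambda>\<sigma>. \<beta> ` \<sigma>) ` ?K"
    by (simp_all add: h_def image_image image_comp)
  ultimately have "complex_iso (free_complex (ring_sites n) (even_faces n)) (wedge 2 ?K b)"
    unfolding free_even_faces[OF n] \<alpha>(2) \<beta>(2) using complex_iso_sym by simp
  moreover have "fin_complex (free_complex (ring_sites n) (even_faces n))"
    using same_type_ring_even[OF n] by (simp add: same_simple_homotopy_type_def)
  ultimately show ?thesis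
    using same_type_ring_even[OF n] same_type_iso same_type_trans by blast
qed

section \<open>The hexagonal cylinder\<close>

fun site_vertex :: "site \<Rightarrow> nat \<times> nat" where
  "site_vertex (Rung r j) = (if r then 1 else 2, 2 * j - 1)"
| "site_vertex (Mid r j) = (if r then 1 else 2, 2 * j)"

fun vertex_site :: "nat \<times> nat \<Rightarrow> site" where
  "vertex_site (a, c) = (if even c then Mid (a = 1) (c div 2) else Rung (a = 1) (Suc (c div 2)))"

lemma inj_site_vertex: "inj_on site_vertex (ring_sites n)"
proof (rule inj_on_inverseI)
  fix z assume z: "z \<in> ring_sites n"
  show "vertex_site (site_vertex z) = z"
  proof (cases z)
    case (Rung r j)
    \<comment> \<open>Positivity of \<open>j\<close> keeps \<open>2 * j - 1\<close> from being
      truncated at 0.\<close>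
    then obtain i where "j = Suc i"
      using z by (cases j) auto
    then show ?thesis
      using Rung by simp
  qed simp
qed

lemma image_site_vertex: "site_vertex ` ring_sites n = {1, 2} \<times> {1..2 * n}"
proof (intro equalityI subsetI)
  fix v :: "nat \<times> nat" assume "v \<in> {1, 2} \<times> {1..2 * n}"
  then obtain a c where v: "v = (a, c)" "a = 1 \<or> a = 2" "1 \<le> c" "c \<le> 2 * n"
    by auto
  have "v = site_vertex (vertex_site v)"
    using v(1,2) by auto
  moreover have "vertex_site v \<in> ring_sites n"
    using v(1,3,4) by (auto elim!: oddE)
  ultimately show "v \<in> site_vertex ` ring_sites n"
    by (rule image_eqI)
qed (auto simp: ring_sites_def)

section \<open>Vertices and endpoint sets of the cylinder graph\<close>

lemma independence_complex_free:
  "independence_complex G = free_complex (verts G) (ends G ` edges G)"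
  by (auto simp: independence_complex_def free_complex_def)

lemma verts_hex_cyl_graph:
  assumes "1 \<le> n"
  shows "verts (hex_cyl_graph 1 n) = {1, 2} \<times> {1..2 * n}"
proof -
  have "glue_vertex (2 * n) ` ({1..2} \<times> {1..2 * n + 1}) = {1, 2} \<times> {1..2 * n}"
  proof (intro equalityI subsetI)
    fix v :: "nat \<times> nat" assume v: "v \<in> {1, 2} \<times> {1..2 * n}"
    then have "v = glue_vertex (2 * n) v" "v \<in> {1..2} \<times> {1..2 * n + 1}"
      by (auto simp: glue_vertex_def)
    then show "v \<in> glue_vertex (2 * n) ` ({1..2} \<times> {1..2 * n + 1})"
      by (rule image_eqI)
  qed (use assms in \<open>auto simp: glue_vertex_def\<close>)
  then show ?thesis
    by (simp add: hex_cyl_graph_def cyl_graph_def identify_def grid_graph_def Let_def numeral_2_eq_2)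
qed

lemma ends_hex_cyl_graph:
  assumes "1 \<le> n"
  shows "ends (hex_cyl_graph 1 n) ` edges (hex_cyl_graph 1 n) =
    (\<lambda>(a, c). {(a, c), glue_vertex (2 * n) (a, c + 1)}) ` ({1, 2} \<times> {1..2 * n}) \<union>
    (\<lambda>c. {(1, c), (2, c)}) ` {c \<in> {1..2 * n}. odd c}" (is "_ = ?H \<union> ?R")
proof -
  let ?g = "glue_vertex (2 * n)"
  let ?rung = "\<lambda>c. {(1, c), (2 :: nat, c :: nat)}"
  define V where "V = {1..2 :: nat} \<times> {1..2 * n + 1}"
  define E where "E = {{u, v} |u v. u \<in> V \<and> v \<in> V \<and> grid_adjacent u v}"
  define D where "D = ?rung ` {c \<in> {1..2 * n}. even c}"
  \<comment> \<open>\<open>glue_edge\<close> renames only edges inside the last column and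
    \<open>glue_vertex\<close> is idempotent, so the renaming is invisible in the endpoint
    sets.\<close>
  have glue: "?g ` glue_edge (2 * n) e = ?g ` e" for e
    using assms by (auto simp: glue_edge_def glue_vertex_def image_image)
  have grid: "E = (\<lambda>(a, c). {(a, c), (a, c + 1)}) ` ({1, 2} \<times> {1..2 * n}) \<union> ?rung ` {1..2 * n + 1}"
    (is "_ = ?Hg \<union> ?Rg")
  proof (intro equalityI subsetI)
    fix e assume "e \<in> E"
    then obtain a c a' c' where e: "e = {(a, c), (a', c')}" and V: "(a, c) \<in> V" "(a', c') \<in> V"
        and adj: "grid_adjacent (a, c) (a', c')"
      unfolding E_def by auto
    have H: "{(x, y), (x, y + 1)} \<in> ?Hg \<union> ?Rg" if "(x, y) \<in> V" "(x, y + 1) \<in> V" for x y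
      using that unfolding V_def by (intro UnI1 image_eqI[of _ _ "(x, y)"]) auto
    have R: "?rung y \<in> ?Hg \<union> ?Rg" if "(1, y) \<in> V" for y
      using that unfolding V_def by (intro UnI2 imageI) auto
    consider "a = a'" "c = c' + 1" | "a = a'" "c' = c + 1" | "c = c'" "a = 2" "a' = 1" | "c = c'" "a = 1" "a' = 2"
      using adj V unfolding grid_adjacent_def V_def by auto
    then show "e \<in> ?Hg \<union> ?Rg"
    proof cases
      case 1
      then show ?thesis
        using e V H[of a c'] by (simp add: insert_commute)
    next
      case 2
      then show ?thesis
        using e V H[of a c] by simp
    next
      case 3
      then show ?thesis
        using e V R[of c] by (simp add: insert_commute)
    next
      case 4
      then show ?thesis
        using e V R[of c] by simp
    qed
  next
    have E: "{u, v} \<in> E" if "u \<in> V" "v \<in> V" "grid_adjacent u v" for u v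
      using that unfolding E_def by blast
    fix e assume "e \<in> ?Hg \<union> ?Rg"
    then show "e \<in> E"
      by (elim UnE imageE) (auto intro!: E simp: V_def grid_adjacent_def)
  qed
  \<comment> \<open>With two rows only \<open>i = 2\<close> occurs, and \<open>2 - j\<close> is even
    exactly in the even columns.\<close>
  have removed: "(\<exists>i j. 2 \<le> i \<and> i \<le> 1 + 1 \<and> 1 \<le> j \<and> j \<le> 2 * n \<and> even (int i - int j) \<and>
      e = {(i, j), (i - 1, j)}) \<longleftrightarrow> e \<in> D" for e :: "(nat \<times> nat) set"
  proof
    assume "\<exists>i j. 2 \<le> i \<and> i \<le> 1 + 1 \<and> 1 \<le> j \<and> j \<le> 2 * n \<and> even (int i - int j) \<and> e = {(i, j), (i - 1, j)}"
    then obtain i j where "2 \<le> i" "i \<le> 1 + 1" and j: "1 \<le> j" "j \<le> 2 * n" "even (int i - int j)"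
        "e = {(i, j), (i - 1, j)}"
      by blast
    then have "i = 2"
      by simp
    then show "e \<in> D"
      unfolding D_def by (intro image_eqI[of _ _ j]) (use j in \<open>auto simp: insert_commute\<close>)
  next
    assume "e \<in> D"
    then obtain j where j: "e = ?rung j" "1 \<le> j" "j \<le> 2 * n" "even j"
      unfolding D_def by (elim imageE) auto
    show "\<exists>i j. 2 \<le> i \<and> i \<le> 1 + 1 \<and> 1 \<le> j \<and> j \<le> 2 * n \<and> even (int i - int j) \<and> e = {(i, j), (i - 1, j)}"
      by (rule exI[of _ 2], rule exI[of _ j]) (use j in \<open>simp add: insert_commute\<close>)
  qed
  have ends: "ends (hex_cyl_graph 1 n) = (\<lambda>e. ?g ` e)"
    by (simp add: hex_cyl_graph_def cyl_graph_def identify_def grid_graph_def Let_def)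
  have "edges (hex_cyl_graph 1 n) = glue_edge (2 * n) ` E - {e. ?g ` e \<in> D}"
    unfolding removed[symmetric] E_def V_def
    by (simp add: hex_cyl_graph_def cyl_graph_def identify_def grid_graph_def Let_def numeral_2_eq_2)
  \<comment> \<open>Removal is decided by the endpoint set alone, so it commutes with passing to
    endpoint sets.\<close>
  then have "ends (hex_cyl_graph 1 n) ` edges (hex_cyl_graph 1 n) =
      (\<lambda>e. ?g ` e) ` glue_edge (2 * n) ` E - D"
    unfolding ends by auto
  also have "(\<lambda>e. ?g ` e) ` glue_edge (2 * n) ` E = (\<lambda>e. ?g ` e) ` E"
    by (simp add: image_image[of "\<lambda>e. ?g ` e"] glue)
  also have "\<dots> = ?H \<union> ?rung ` {1..2 * n}"
  proof -
    have "(\<lambda>e. ?g ` e) ` (\<lambda>(a, c). {(a, c), (a, c + 1)}) ` ({1, 2} \<times> {1..2 * n}) =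
        (\<lambda>p. ?g ` (case p of (a, c) \<Rightarrow> {(a, c), (a, c + 1)})) ` ({1, 2} \<times> {1..2 * n})"
      by (rule image_image)
    also have "\<dots> = ?H"
    proof -
      have "?g ` (case p of (a, c) \<Rightarrow> {(a, c), (a, c + 1)}) = (case p of (a, c) \<Rightarrow> {(a, c), ?g (a, c + 1)})"
        if p: "p \<in> {1, 2} \<times> {1..2 * n}" for p :: "nat \<times> nat"
      proof -
        obtain a c where "p = (a, c)" "c \<le> 2 * n"
          using p by auto
        then show ?thesis
          by (simp add: glue_vertex_def)
      qed
      then show ?thesis
        by (rule image_cong[OF refl])
    qed
    finally have "(\<lambda>e. ?g ` e) ` (\<lambda>(a, c). {(a, c), (a, c + 1)}) ` ({1, 2} \<times> {1..2 * n}) = ?H" .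
    \<comment> \<open>The rung of column \<open>2 * n + 1\<close> is glued onto that of column
      1.\<close>
    moreover have "?g ` ?rung c = ?rung (if c = 2 * n + 1 then 1 else c)" for c
      by (simp add: glue_vertex_def)
    then have "(\<lambda>e. ?g ` e) ` ?rung ` {1..2 * n + 1} =
        ?rung ` (\<lambda>c. if c = 2 * n + 1 then 1 else c) ` {1..2 * n + 1}"
      by (simp only: image_image)
    moreover have "(\<lambda>c. if c = 2 * n + 1 then 1 else c) ` {1..2 * n + 1} = {1..2 * n}"
    proof (intro equalityI subsetI)
      fix c assume "c \<in> {1..2 * n}"
      then show "c \<in> (\<lambda>c. if c = 2 * n + 1 then 1 else c) ` {1..2 * n + 1}"
        by (intro image_eqI[of _ _ c]) auto
    qed (use assms in auto)
    ultimately show ?thesis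
      by (simp only: grid image_Un)
  qed
  also have "\<dots> - D = ?H \<union> ?R"
  proof -
    \<comment> \<open>Horizontal edges stay in one row, whereas the removed rungs meet both.\<close>
    have "e \<notin> D" if "e \<in> ?H" for e
    proof
      assume "e \<in> D"
      then have "fst ` e = {1, 2}"
        by (auto simp: D_def)
      moreover obtain a where "fst ` e = {a}"
        using \<open>e \<in> ?H\<close> by (auto simp: glue_vertex_def)
      ultimately show False
        by auto
    qed
    then have "?H - D = ?H"
      by (meson Diff_triv disjoint_iff)
    moreover have "inj ?rung"
      by (auto simp: inj_def doubleton_eq_iff)
    then have "?rung ` {1..2 * n} - D = ?rung ` ({1..2 * n} - {c \<in> {1..2 * n}. even c})"
      unfolding D_def by (rule image_set_diff[symmetric])
    moreover have "{1..2 * n} - {c \<in> {1..2 * n}. even c} = {c \<in> {1..2 * n}. odd c}"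
      by auto
    ultimately show ?thesis
      by (simp only: Un_Diff)
  qed
  finally show ?thesis .
qed

text \<open>A horizontal edge leaving an odd column goes from a rung to a middle vertex, one leaving
  an even column from a middle vertex to the next rung. Gluing acts only at column
  \<open>2 * n\<close>, which is the case \<open>j = n\<close> of the ring.\<close>

lemma image_ring_edges:
  assumes "1 \<le> n"
  shows "(\<lambda>f. site_vertex ` f) ` ring_edges n =
    (\<lambda>(a, c). {(a, c), glue_vertex (2 * n) (a, c + 1)}) ` ({1, 2} \<times> {1..2 * n}) \<union>
    (\<lambda>c. {(1, c), (2, c)}) ` {c \<in> {1..2 * n}. odd c}" (is "?L = ?H \<union> ?R")
proof (intro equalityI subsetI)
  fix e assume "e \<in> ?L"
  then obtain f where "f \<in> ring_edges n" and e: "e = site_vertex ` f"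
    by (elim imageE)
  then show "e \<in> ?H \<union> ?R"
  proof (cases rule: ring_edgesE)
    case (1 r j)
    then show ?thesis
      using e by (intro UnI1 image_eqI[of _ _ "(if r then 1 else 2, 2 * j - 1)"]) (auto simp: glue_vertex_def)
  next
    case (2 r j)
    then show ?thesis
      using e by (intro UnI1 image_eqI[of _ _ "(if r then 1 else 2, 2 * j)"]) (auto simp: glue_vertex_def)
  next
    case (3 j)
    then show ?thesis
      using e by (intro UnI2 image_eqI[of _ _ "2 * j - 1"]) auto
  qed
next
  have L: "site_vertex ` f \<in> ?L" if "f \<in> ring_edges n" for f
    using that by (rule imageI)
  fix e assume "e \<in> ?H \<union> ?R"
  then consider a c where "e = {(a, c), glue_vertex (2 * n) (a, c + 1)}" "a = 1 \<or> a = 2" "1 \<le> c" "c \<le> 2 * n"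
    | c where "e = {(1, c), (2, c)}" "c \<le> 2 * n" "odd c"
    by (elim UnE imageE) auto
  then show "e \<in> ?L"
  proof cases
    case (1 a c)
    show ?thesis
    proof (cases "even c")
      case True
      then obtain j where j: "c = 2 * j"
        by blast
      then have "e = site_vertex ` {Mid (a = 1) j, Rung (a = 1) (if j = n then 1 else j + 1)}"
        using 1 by (auto simp: glue_vertex_def)
      moreover have "{Mid (a = 1) j, Rung (a = 1) (if j = n then 1 else j + 1)} \<in> ring_edges n"
        using 1(3,4) j ring_edge_next[of j n "a = 1"] ring_edge_last[of n "a = 1"] assms by auto
      ultimately show ?thesis
        by (simp only: L)
    next
      case False
      then obtain j where j: "c = 2 * j + 1"
        by (rule oddE)
      have "c \<noteq> 2 * n" "Suc j \<le> n"
        using 1(4) j by presburger+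
      then have "e = {(a, c), (a, c + 1)}"
        using 1(1) by (simp add: glue_vertex_def)
      also have "\<dots> = site_vertex ` {Rung (a = 1) (Suc j), Mid (a = 1) (Suc j)}"
        using 1(2) j by auto
      finally have "e = site_vertex ` {Rung (a = 1) (Suc j), Mid (a = 1) (Suc j)}" .
      moreover have "{Rung (a = 1) (Suc j), Mid (a = 1) (Suc j)} \<in> ring_edges n"
        using ring_edge_mid[of "Suc j" n] \<open>Suc j \<le> n\<close> by simp
      ultimately show ?thesis
        by (simp only: L)
    qed
  next
    case (2 c)
    from 2(3) obtain j where j: "c = 2 * j + 1"
      by (rule oddE)
    then have "e = site_vertex ` {Rung True (Suc j), Rung False (Suc j)}"
      using 2 by auto
    moreover have "{Rung True (Suc j), Rung False (Suc j)} \<in> ring_edges n"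
      using 2(2) j ring_edge_rung[of "Suc j" n True] by auto
    ultimately show ?thesis
      by (simp only: L)
  qed
qed

lemma independence_complex_hex_cyl_graph:
  assumes "1 \<le> n"
  shows "independence_complex (hex_cyl_graph 1 n) =
    (\<lambda>\<sigma>. site_vertex ` \<sigma>) ` free_complex (ring_sites n) (ring_edges n)"
proof -
  have "free_complex (site_vertex ` ring_sites n) ((\<lambda>f. site_vertex ` f) ` ring_edges n) =
      (\<lambda>\<sigma>. site_vertex ` \<sigma>) ` free_complex (ring_sites n) (ring_edges n)"
    by (rule free_complex_image[OF inj_site_vertex ring_edges_subset])
  then show ?thesis
    unfolding independence_complex_free verts_hex_cyl_graph[OF assms] ends_hex_cyl_graph[OF assms]
      image_ring_edges[OF assms] image_site_vertex .
qed

lemma same_type_hex_cyl_graph: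
  assumes "1 \<le> n"
  shows "same_simple_homotopy_type (independence_complex (hex_cyl_graph 1 n))
    (free_complex (ring_sites n) (ring_edges n))"
proof (rule same_type_sym, rule same_type_iso)
  show "fin_complex (free_complex (ring_sites n) (ring_edges n))"
    using finite_ring_sites empty_ring_edges by (rule fin_complex_free)
  have "inj_on site_vertex (\<Union>(free_complex (ring_sites n) (ring_edges n)))"
    by (rule inj_on_subset[OF inj_site_vertex[of n]]) (auto simp: free_complex_def)
  then show "complex_iso (free_complex (ring_sites n) (ring_edges n)) (independence_complex (hex_cyl_graph 1 n))"
    unfolding complex_iso_def independence_complex_hex_cyl_graph[OF assms] by blast
qed

theorem corollary1p7:
  fixes k i :: nat
  assumes "i \<in> {0, 1}" and "2 * k + i \<ge> 1"
  shows "(i = 0 \<longrightarrow>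
            (\<forall>b. (\<forall>j<2. {b j} \<in> diamond (2 * k - 1)) \<longrightarrow>
               same_simple_homotopy_type
                 (independence_complex (hex_cyl_graph 1 (2 * k + i)))
                 (wedge 2 (diamond (2 * k - 1)) b))) \<and>
         (i = 1 \<longrightarrow>
            same_simple_homotopy_type
              (independence_complex (hex_cyl_graph 1 (2 * k + i)))
              point_complex)"
proof (intro conjI impI allI)
  fix b :: "nat \<Rightarrow> nat \<times> nat" assume i: "i = 0" and b: "\<forall>j<2. {b j} \<in> diamond (2 * k - 1)"
  \<comment> \<open>Here the second assumption gives \<open>k \<ge> 1\<close>, so the ring has
    length at least 2 and \<open>2 * k - 1\<close> is not truncated.\<close>
  then have "same_simple_homotopy_type (free_complex (ring_sites (2 * k + i)) (ring_edges (2 * k + i)))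
      (wedge 2 (diamond (2 * k - 1)) b)"
    using same_type_ring_wedge[of "2 * k" b] assms(2) by simp
  then show "same_simple_homotopy_type (independence_complex (hex_cyl_graph 1 (2 * k + i)))
      (wedge 2 (diamond (2 * k - 1)) b)"
    using same_type_hex_cyl_graph[OF assms(2)] same_type_trans by blast
next
  assume "i = 1"
  then have "same_simple_homotopy_type (free_complex (ring_sites (2 * k + i)) (ring_edges (2 * k + i))) point_complex"
    by (intro same_type_ring_odd) simp
  then show "same_simple_homotopy_type (independence_complex (hex_cyl_graph 1 (2 * k + i))) point_complex"
    using same_type_hex_cyl_graph[OF assms(2)] same_type_trans by blast
qed

end
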